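(* There exists a constant $K>0$ such that, for any symmetric probability measures $\mu_{H_1}$ and $\mu_{H_2}$ on two finitely generated groups $H_1$ and $H_2$, the switch-or-walk measure $q=\frac12(\mu_{H_1}+\mu_{H_2})$ on the wreath product $H_1\wr H_2$ satisfies, for every $s>0$, $$\Lambda_{H_1\wr H_2,q}(v)\ge s/K\quad\text{for any } v\le\Lambda^{-1}_{H_1,\mu_{H_1}}(s)^{\Lambda^{-1}_{H_2,\mu_{H_2}}(s)/K}.$$ In the other direction, for every $s>0$, $$\Lambda_{H_1\wr H_2,q}(v)\le s\quad\text{for } v\ge\Lambda^{-1}_{H_1,\mu_{H_1}}(s)^{\Lambda^{-1}_{H_2,\mu_{H_2}}(s)}\,\Lambda^{-1}_{H_2,\mu_{H_2}}(s).$$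
   Context: For a symmetric probability measure $\phi$ on a countable group $G$, $\mathcal E_\phi(f,f)=\frac12\sum_{x,y\in G}|f(xy)-f(x)|^2\phi(y)$ and, for real $v>0$, $$\Lambda_{G,\phi}(v)=\inf\{\mathcal E_\phi(f,f):|\mathrm{support}(f)|\le v,\ \|f\|_2=1\}$$ (with $\inf\emptyset=+\infty$, so $\Lambda_{G,\phi}(v)=+\infty$ for $v<1$). Its right-continuous inverse is $\Lambda_{G,\phi}^{-1}(s)=\inf\{v:\Lambda_{G,\phi}(v)\le s\}\in[1,\infty]$. Conventions: $1^\infty=1$, $a^\infty=\infty$ for $a>1$, $\infty^b=\infty$ for $b>0$. Wreath product: $H_1\wr H_2$ is the set of pairs $(f,h)$ with $h\in H_2$ and $f:H_2\to H_1$ finitely supported ($f(x)=e$ for all but finitely many $x$), with product $(f,h)(f',h')=(f\cdot\tau(h)f',hh')$, $\tau(h)f'(x)=f'(h^{-1}x)$, where functions are multiplied pointwise ($H_1$ is the lamp group, $H_2$ the base). $H_1$ is embedded by sending $k$ to $(\boldsymbol k,e)$ where $\boldsymbol k(e)=k$ and $\boldsymbol k(x)=e$ for $x\ne e$; $H_2$ is embedded by $h\mapsto(\boldsymbol e,h)$ with $\boldsymbol e$ the constant identity function. Via these embeddings $\mu_{H_1},\mu_{H_2}$ are viewed as probability measures on $H_1\wr H_2$.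
   Formalization: The lower bound excludes the point v = 1 when both inverse profiles at s equal 1, where the claim fails (Λ_q(1) ≤ 1 but s may be arbitrarily large); groups are taken with underlying set in the natural numbers, which covers every finitely generated group up to isomorphism. *)

theory Defs
  imports "HOL-Algebra.Algebra" "HOL-Probability.Probability"
begin

section \<open>Groups and probability measures\<close>

definition finitely_generated_group :: "('a, 'c) monoid_scheme \<Rightarrow> bool" where
  "finitely_generated_group G \<longleftrightarrow>
     group G \<and> (\<exists>S. finite S \<and> S \<subseteq> carrier G \<and> generate G S = carrier G)"

text \<open>A probability measure on the countable group \<open>G\<close> is a \<open>pmf\<close> on the underlying type that
  charges only the carrier.\<close>

definition symmetric_pmf_on :: "('a, 'c) monoid_scheme \<Rightarrow> 'a pmf \<Rightarrow> bool" where
  "symmetric_pmf_on G \<phi> \<longleftrightarrow>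
     set_pmf \<phi> \<subseteq> carrier G \<and> (\<forall>x\<in>carrier G. pmf \<phi> (inv\<^bsub>G\<^esub> x) = pmf \<phi> x)"


section \<open>Dirichlet form and \<open>L\<^sup>2\<close>-isoperimetric profile\<close>

text \<open>Functions on \<open>G\<close> are total functions on the underlying type; only their values on the carrier
  matter below.\<close>

definition supp_on :: "('a, 'c) monoid_scheme \<Rightarrow> ('a \<Rightarrow> real) \<Rightarrow> 'a set" where
  "supp_on G f = {x \<in> carrier G. f x \<noteq> 0}"

definition l2_norm_on :: "('a, 'c) monoid_scheme \<Rightarrow> ('a \<Rightarrow> real) \<Rightarrow> real" where
  "l2_norm_on G f = sqrt (\<Sum>\<^sub>\<infinity>x\<in>carrier G. (f x)\<^sup>2)"

definition dirichlet_form :: "('a, 'c) monoid_scheme \<Rightarrow> 'a pmf \<Rightarrow> ('a \<Rightarrow> real) \<Rightarrow> ennreal" where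
  "dirichlet_form G \<phi> f =
     ennreal (1/2) * (\<Sum>\<^sub>\<infinity>(x, y)\<in>carrier G \<times> carrier G.
                        ennreal (\<bar>f (x \<otimes>\<^bsub>G\<^esub> y) - f x\<bar>\<^sup>2 * pmf \<phi> y))"

text \<open>Finiteness of the support is explicit because \<open>card\<close> of an infinite set is \<open>0\<close>.  In
  \<open>ennreal\<close> the infimum of the empty set is \<open>\<infinity>\<close>, so the profile is \<open>\<infinity>\<close> for \<open>v < 1\<close>.\<close>

definition l2_profile :: "('a, 'c) monoid_scheme \<Rightarrow> 'a pmf \<Rightarrow> real \<Rightarrow> ennreal" where
  "l2_profile G \<phi> v =
     (INF f\<in>{f. finite (supp_on G f) \<and> real (card (supp_on G f)) \<le> v \<and> l2_norm_on G f = 1}.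
        dirichlet_form G \<phi> f)"

definition l2_profile_inv :: "('a, 'c) monoid_scheme \<Rightarrow> 'a pmf \<Rightarrow> real \<Rightarrow> ennreal" where
  "l2_profile_inv G \<phi> s = (INF v\<in>{v. 0 < v \<and> l2_profile G \<phi> v \<le> ennreal s}. ennreal v)"

text \<open>Powers \<open>a\<^sup>b\<close> for \<open>a \<in> [1,\<infinity>]\<close> and \<open>b \<in> (0,\<infinity>]\<close>, with \<open>1\<^sup>\<infinity> = 1\<close>, \<open>a\<^sup>\<infinity> = \<infinity>\<close> for \<open>a > 1\<close> and
  \<open>\<infinity>\<^sup>b = \<infinity>\<close>; values outside this range are irrelevant.\<close>

definition epowr :: "ennreal \<Rightarrow> ennreal \<Rightarrow> ennreal" where
  "epowr a b =
     (if a = 1 then 1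
      else if a = \<infinity> \<or> b = \<infinity> then \<infinity>
      else ennreal (enn2real a powr enn2real b))"


section \<open>Wreath products\<close>

text \<open>\<open>H1\<close> is the lamp group and \<open>H2\<close> the base.  Lamp configurations are the elements of the
  restricted direct power \<open>sum_group (carrier H2) (\<lambda>_. H1)\<close>; they are extensional, that is,
  \<open>undefined\<close> off the carrier of \<open>H2\<close>.\<close>

abbreviation lamp_group ::
    "('a, 'c) monoid_scheme \<Rightarrow> ('b, 'd) monoid_scheme \<Rightarrow> ('b \<Rightarrow> 'a) monoid" where
  "lamp_group H1 H2 \<equiv> sum_group (carrier H2) (\<lambda>_. H1)"

definition translate :: "('b, 'd) monoid_scheme \<Rightarrow> 'b \<Rightarrow> ('b \<Rightarrow> 'a) \<Rightarrow> 'b \<Rightarrow> 'a" where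
  "translate H2 h f = (\<lambda>x\<in>carrier H2. f (inv\<^bsub>H2\<^esub> h \<otimes>\<^bsub>H2\<^esub> x))"

definition wreath_product ::
    "('a, 'c) monoid_scheme \<Rightarrow> ('b, 'd) monoid_scheme \<Rightarrow> (('b \<Rightarrow> 'a) \<times> 'b) monoid" where
  "wreath_product H1 H2 =
     \<lparr>carrier = carrier (lamp_group H1 H2) \<times> carrier H2,
      monoid.mult = (\<lambda>(f, h) (f', h').
        (f \<otimes>\<^bsub>lamp_group H1 H2\<^esub> translate H2 h f', h \<otimes>\<^bsub>H2\<^esub> h')),
      one = (\<one>\<^bsub>lamp_group H1 H2\<^esub>, \<one>\<^bsub>H2\<^esub>)\<rparr>"

definition lamp_embed ::
    "('a, 'c) monoid_scheme \<Rightarrow> ('b, 'd) monoid_scheme \<Rightarrow> 'a \<Rightarrow> ('b \<Rightarrow> 'a) \<times> 'b" where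
  "lamp_embed H1 H2 k =
     (\<lambda>x\<in>carrier H2. if x = \<one>\<^bsub>H2\<^esub> then k else \<one>\<^bsub>H1\<^esub>, \<one>\<^bsub>H2\<^esub>)"

definition base_embed ::
    "('a, 'c) monoid_scheme \<Rightarrow> ('b, 'd) monoid_scheme \<Rightarrow> 'b \<Rightarrow> ('b \<Rightarrow> 'a) \<times> 'b" where
  "base_embed H1 H2 h = (\<lambda>x\<in>carrier H2. \<one>\<^bsub>H1\<^esub>, h)"

definition switch_or_walk ::
    "('a, 'c) monoid_scheme \<Rightarrow> ('b, 'd) monoid_scheme \<Rightarrow> 'a pmf \<Rightarrow> 'b pmf \<Rightarrow>
     (('b \<Rightarrow> 'a) \<times> 'b) pmf" where
  "switch_or_walk H1 H2 \<mu>1 \<mu>2 =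
     bind_pmf (bernoulli_pmf (1/2))
       (\<lambda>c. if c then map_pmf (lamp_embed H1 H2) \<mu>1 else map_pmf (base_embed H1 H2) \<mu>2)"

lemma pmf_switch_or_walk:
  "pmf (switch_or_walk H1 H2 \<mu>1 \<mu>2) g =
     1/2 * (pmf (map_pmf (lamp_embed H1 H2) \<mu>1) g + pmf (map_pmf (base_embed H1 H2) \<mu>2) g)"
  by (simp add: switch_or_walk_def pmf_bind)

lemma translate_lamp_group:
  assumes "group H1" "group H2" "h \<in> carrier H2" "f \<in> carrier (lamp_group H1 H2)"
  shows "translate H2 h f \<in> carrier (lamp_group H1 H2)"
proof -
  interpret H1: group H1 by fact
  interpret H2: group H2 by fact
  have f: "f \<in> carrier H2 \<rightarrow>\<^sub>E carrier H1" "finite {i \<in> carrier H2. f i \<noteq> \<one>\<^bsub>H1\<^esub>}"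
    using assms by (auto simp: carrier_sum_group)
  have "{i \<in> carrier H2. translate H2 h f i \<noteq> \<one>\<^bsub>H1\<^esub>}
        \<subseteq> (\<lambda>i. h \<otimes>\<^bsub>H2\<^esub> i) ` {i \<in> carrier H2. f i \<noteq> \<one>\<^bsub>H1\<^esub>}"
  proof
    fix i assume i: "i \<in> {i \<in> carrier H2. translate H2 h f i \<noteq> \<one>\<^bsub>H1\<^esub>}"
    then have "i = h \<otimes>\<^bsub>H2\<^esub> (inv\<^bsub>H2\<^esub> h \<otimes>\<^bsub>H2\<^esub> i)"
      using assms(3) by (simp add: H2.m_assoc [symmetric])
    then show "i \<in> (\<lambda>i. h \<otimes>\<^bsub>H2\<^esub> i) ` {i \<in> carrier H2. f i \<noteq> \<one>\<^bsub>H1\<^esub>}"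
      using i assms(3) by (intro image_eqI) (auto simp: translate_def)
  qed
  then have "finite {i \<in> carrier H2. translate H2 h f i \<noteq> \<one>\<^bsub>H1\<^esub>}"
    using f(2) finite_surj by blast
  moreover have "translate H2 h f \<in> carrier H2 \<rightarrow>\<^sub>E carrier H1"
    using f(1) assms(3) by (auto simp: translate_def PiE_iff)
  ultimately show ?thesis
    using assms by (simp add: carrier_sum_group)
qed

lemma group_wreath_product:
  assumes "group H1" "group H2"
  shows "group (wreath_product H1 H2)"
proof -
  interpret H1: group H1 by fact
  interpret H2: group H2 by fact
  interpret L: group "lamp_group H1 H2"
    using assms by simp
  note tr [simp] = translate_lamp_group [OF assms]
  have ext: "f \<in> carrier H2 \<rightarrow>\<^sub>E carrier H1" if "f \<in> carrier (lamp_group H1 H2)" for f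
    using that assms by (simp add: carrier_sum_group)
  have tmul: "translate H2 h (f \<otimes>\<^bsub>lamp_group H1 H2\<^esub> g)
      = translate H2 h f \<otimes>\<^bsub>lamp_group H1 H2\<^esub> translate H2 h g"
    if "h \<in> carrier H2" for h f g
    using that by (auto simp: translate_def)
  have ttr: "translate H2 h (translate H2 k f) = translate H2 (h \<otimes>\<^bsub>H2\<^esub> k) f"
    if "h \<in> carrier H2" "k \<in> carrier H2" for h k f
    using that by (auto simp: translate_def H2.m_assoc H2.inv_mult_group)
  have tone: "translate H2 \<one>\<^bsub>H2\<^esub> f = f" if "f \<in> carrier (lamp_group H1 H2)" for f
    using ext [OF that] by (auto simp: translate_def PiE_iff extensional_def)
  show ?thesis
  proof (rule groupI)
    fix x assume x: "x \<in> carrier (wreath_product H1 H2)"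
    obtain f h where fh: "x = (f, h)" by (cases x)
    have f: "f \<in> carrier (lamp_group H1 H2)" and h: "h \<in> carrier H2"
      using x by (simp_all add: fh wreath_product_def)
    define g where "g = translate H2 (inv\<^bsub>H2\<^esub> h) (inv\<^bsub>lamp_group H1 H2\<^esub> f)"
    have "g \<otimes>\<^bsub>lamp_group H1 H2\<^esub> translate H2 (inv\<^bsub>H2\<^esub> h) f
          = translate H2 (inv\<^bsub>H2\<^esub> h) (inv\<^bsub>lamp_group H1 H2\<^esub> f \<otimes>\<^bsub>lamp_group H1 H2\<^esub> f)"
      unfolding g_def using h by (intro tmul [symmetric]) simp
    also have "\<dots> = translate H2 (inv\<^bsub>H2\<^esub> h) \<one>\<^bsub>lamp_group H1 H2\<^esub>"
      using f by (metis L.l_inv)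
    also have "\<dots> = \<one>\<^bsub>lamp_group H1 H2\<^esub>"
      using h by (auto simp: translate_def)
    finally have "(g, inv\<^bsub>H2\<^esub> h) \<otimes>\<^bsub>wreath_product H1 H2\<^esub> x = \<one>\<^bsub>wreath_product H1 H2\<^esub>"
      using h unfolding wreath_product_def fh by simp
    moreover have "(g, inv\<^bsub>H2\<^esub> h) \<in> carrier (wreath_product H1 H2)"
      using h tr [OF H2.inv_closed [OF h] L.inv_closed [OF f]]
      unfolding wreath_product_def g_def by simp
    ultimately show "\<exists>y\<in>carrier (wreath_product H1 H2).
        y \<otimes>\<^bsub>wreath_product H1 H2\<^esub> x = \<one>\<^bsub>wreath_product H1 H2\<^esub>"
      by blast
  next
    fix x y z
    assume "x \<in> carrier (wreath_product H1 H2)" "y \<in> carrier (wreath_product H1 H2)"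
      "z \<in> carrier (wreath_product H1 H2)"
    then show "x \<otimes>\<^bsub>wreath_product H1 H2\<^esub> y \<otimes>\<^bsub>wreath_product H1 H2\<^esub> z
        = x \<otimes>\<^bsub>wreath_product H1 H2\<^esub> (y \<otimes>\<^bsub>wreath_product H1 H2\<^esub> z)"
      by (cases x; cases y; cases z)
        (simp add: wreath_product_def tmul ttr L.m_assoc H2.m_assoc del: mult_sum_group)
  next
    fix x y
    assume "x \<in> carrier (wreath_product H1 H2)" "y \<in> carrier (wreath_product H1 H2)"
    then show "x \<otimes>\<^bsub>wreath_product H1 H2\<^esub> y \<in> carrier (wreath_product H1 H2)"
      by (cases x; cases y) (simp add: wreath_product_def del: mult_sum_group)
  next
    fix x assume "x \<in> carrier (wreath_product H1 H2)"
    then show "\<one>\<^bsub>wreath_product H1 H2\<^esub> \<otimes>\<^bsub>wreath_product H1 H2\<^esub> x = x"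
      by (cases x) (simp add: wreath_product_def tone del: mult_sum_group one_sum_group)
  qed (simp add: wreath_product_def del: one_sum_group)
qed


section \<open>Finitely generated groups with carrier in \<open>nat\<close>\<close>

text \<open>A constant uniform over all finitely generated groups cannot be stated with type variables
  for the groups, since the constant could then depend on the types.  Nothing is lost by taking
  carriers in \<open>nat\<close>: every finitely generated group has an isomorphic copy there.\<close>

lemma countable_generate:
  fixes G (structure)
  assumes "countable S"
  shows "countable (generate G S)"
proof -
  define T where "T = insert \<one>\<^bsub>G\<^esub> (S \<union> (\<lambda>x. inv\<^bsub>G\<^esub> x) ` S)"
  define Y where "Y = rec_nat T (\<lambda>_ A. A \<union> (\<lambda>(x, y). x \<otimes>\<^bsub>G\<^esub> y) ` (A \<times> A))"
  have Y0: "Y 0 = T" and YS: "Y (Suc n) = Y n \<union> (\<lambda>(x, y). x \<otimes>\<^bsub>G\<^esub> y) ` (Y n \<times> Y n)" for n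
    by (simp_all add: Y_def)
  have cY: "countable (Y n)" for n
    by (induction n) (use assms in \<open>auto simp: Y0 YS T_def\<close>)
  have mono: "Y m \<subseteq> Y n" if "m \<le> n" for m n
    using that by (rule lift_Suc_mono_le [rotated]) (auto simp: YS)
  have "x \<in> (\<Union>n. Y n)" if "x \<in> generate G S" for x
    using that
  proof induction
    case (eng h1 h2)
    then obtain m n where "h1 \<in> Y m" "h2 \<in> Y n" by blast
    then have "h1 \<in> Y (max m n)" "h2 \<in> Y (max m n)"
      using mono [of m "max m n"] mono [of n "max m n"] by auto
    then have "h1 \<otimes>\<^bsub>G\<^esub> h2 \<in> Y (Suc (max m n))"
      by (auto simp: YS)
    then show ?case by blast
  next
    case one
    then show ?case by (intro UN_I [of 0]) (auto simp: Y0 T_def)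
  next
    case (incl h)
    then show ?case by (intro UN_I [of 0]) (auto simp: Y0 T_def)
  next
    case (inv h)
    then show ?case by (intro UN_I [of 0]) (auto simp: Y0 T_def)
  qed
  then show ?thesis
    by (meson cY countable_UN countable_subset countableI_type subsetI)
qed

lemma finitely_generated_group_nat_copy:
  assumes "finitely_generated_group G"
  shows "\<exists>H :: nat monoid. finitely_generated_group H \<and> G \<cong> H"
proof -
  from assms obtain S where G: "group G" and S: "finite S" "S \<subseteq> carrier G"
      "generate G S = carrier G"
    by (auto simp: finitely_generated_group_def)
  interpret group G by fact
  define f where "f = to_nat_on (carrier G)"
  have inj: "inj_on f (carrier G)"
    using countable_generate [of S G] S by (metis f_def countable_finite inj_on_to_nat_on)
  have iso: "f \<in> iso G (image_group f G)"
    using inj by (rule inj_imp_image_group_iso)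
  have H: "group (image_group f G)"
    using inj by (rule inj_imp_image_group_is_group)
  interpret h: group_hom G "image_group f G" f
    using iso G H by (simp add: group_hom_def group_hom_axioms_def iso_def)
  have "generate (image_group f G) (f ` S) = carrier (image_group f G)"
    using h.generate_img [OF S(2)] S(3) by (simp add: image_group_carrier)
  then have "finitely_generated_group (image_group f G)"
    using H S unfolding finitely_generated_group_def
    by (intro conjI exI [of _ "f ` S"]) (auto simp: image_group_carrier)
  then show ?thesis
    using iso by (auto simp: is_iso_def)
qed

end

theory Submission
  imports Defs
begin

text \<open>
  Call a set \<open>{f} \<times> H\<^sub>2\<close> in \<open>H\<^sub>1 \<wr> H\<^sub>2\<close> a base line, and call a set of all \<open>(f', h)\<close> where \<open>f'\<close> agrees with a
  given \<open>f\<close> away from the given point \<open>h\<close> a lamp line.  Base lines are copies of \<open>H\<^sub>2\<close>, lamp lines are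
  copies of \<open>H\<^sub>1\<close>, and the Dirichlet form of the switch-or-walk measure is exactly half the sum of
  the Dirichlet forms of the restrictions to all these lines (\<open>dirichlet_form_switch_or_walk\<close>).
  Both inequalities come from this identity.

  \<^bold>\<open>Upper bound.\<close>  If \<open>\<phi>\<^sub>1\<close>, \<open>\<phi>\<^sub>2\<close> are near minimisers for the two groups at level \<open>s\<close>, then
  \<open>F (f, h) = \<phi>\<^sub>2 h \<cdot> (\<Prod>x \<in> supp \<phi>\<^sub>2. \<phi>\<^sub>1 (f x))\<close>, cut off to configurations trivial off \<open>supp \<phi>\<^sub>2\<close>,
  restricts to a multiple of \<open>\<phi>\<^sub>1\<close> or of \<open>\<phi>\<^sub>2\<close> on every line.  Hence its Rayleigh quotient is the average
  of those of \<open>\<phi>\<^sub>1\<close> and \<open>\<phi>\<^sub>2\<close>, while its support has at most \<open>a\<^sup>b b\<close> elements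
  (\<open>l2_profile_wreath_le\<close>).

  \<^bold>\<open>Lower bound.\<close>  Let \<open>A\<close>, \<open>B\<close> be such that functions on \<open>H\<^sub>1\<close> with support smaller than \<open>A\<close>, and
  functions on \<open>H\<^sub>2\<close> with support smaller than \<open>B\<close>, have Rayleigh quotient at least \<open>s\<close>.  Let \<open>F\<close> be a
  unit vector whose energy is small compared with \<open>s\<close>.  On most lines, weighted by mass, the
  restriction of \<open>F\<close> has Rayleigh quotient small compared with \<open>s\<close>, so it cannot be concentrated on few points.  The
  point is to turn this \<open>L\<^sup>2\<close> information into a count without the square that is lost in
  Cheeger-type inequalities.  For a superlevel set \<open>{F\<^sup>2 > t}\<close> only the number of its points
  on each line is needed, and not its boundary: if \<open>t\<^sub>0\<close> is the threshold above which a line contains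
  fewer than \<open>B\<close> points of the superlevel set, then \<open>(\<bar>F\<bar> - \<surd>t\<^sub>0)\<^sub>+\<close> has small support and at most the
  energy of \<open>F\<close>, so its norm is small (\<open>level_threshold\<close>).  Integrating over \<open>t\<close> yields one level at
  which fewer than a quarter of the points of the superlevel set lie on a poor line, that is, on a lamp
  line with fewer than \<open>A\<close> or a base line with fewer than \<open>B\<close> points of that set (\<open>exists_level\<close>).

  The remainder is finite combinatorics.  A nonempty subset can be extracted all of whose lamp lines
  and base lines carry more than \<open>A/2\<close> and \<open>B/4\<close> of its points respectively (\<open>thick_subset\<close>).  Its set
  of lamp configurations therefore admits, at each of its elements, more than \<open>A/2\<close> variations in
  each of more than \<open>B/4\<close> coordinates, and such a set has at least \<open>A\<^bsup>B/8\<^esup>\<close> elements, by induction on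
  the number of coordinates (\<open>card_ge_power_of_variations\<close>).  The slack between the exponents \<open>B/8\<close> and
  \<open>B/K\<close> absorbs the boundary case of equality.
\<close>

section \<open>Sums in the extended nonnegative reals as integrals\<close>

text \<open>Integrals against counting measure come with Fubini's theorem and linearity for arbitrary
  nonnegative functions, which is what the decomposition of energies into lines rests on.  A simple
  function that is nonzero at infinitely many points takes one positive value infinitely often, and
  then both sides are infinite; otherwise its integral is a finite sum.\<close>

lemma infsum_ennreal_eq_nn_integral:
  fixes f :: "'a \<Rightarrow> ennreal"
  shows "infsum f A = (\<integral>\<^sup>+x. f x \<partial>count_space A)"
proof (rule antisym)
  have "infsum f A = (SUP F\<in>{F. finite F \<and> F \<subseteq> A}. sum f F)"
    by (rule nonneg_infsum_complete) simp
  also have "\<dots> \<le> (\<integral>\<^sup>+x. f x \<partial>count_space A)"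
  proof (rule SUP_least)
    fix F assume F: "F \<in> {F. finite F \<and> F \<subseteq> A}"
    then have "sum f F = (\<integral>\<^sup>+x. f x * indicator F x \<partial>count_space A)"
      by (subst nn_integral_count_space'[of F]) (auto simp: indicator_def)
    also have "\<dots> \<le> (\<integral>\<^sup>+x. f x \<partial>count_space A)"
      by (intro nn_integral_mono) (auto simp: indicator_def)
    finally show "sum f F \<le> (\<integral>\<^sup>+x. f x \<partial>count_space A)" .
  qed
  finally show "infsum f A \<le> (\<integral>\<^sup>+x. f x \<partial>count_space A)" .
next
  have sub: "infsum f B \<le> infsum f A" if "B \<subseteq> A" for B
    using that unfolding nonneg_infsum_complete[OF zero_le]
    by (intro SUP_subset_mono) auto
  show "(\<integral>\<^sup>+x. f x \<partial>count_space A) \<le> infsum f A"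
    unfolding nn_integral_def
  proof (rule SUP_least)
    fix g assume "g \<in> {g. simple_function (count_space A) g \<and> g \<le> f}"
    then have g: "simple_function (count_space A) g" and gf: "\<And>x. g x \<le> f x"
      by (auto simp: le_fun_def)
    have eq: "integral\<^sup>S (count_space A) g = (\<integral>\<^sup>+x. g x \<partial>count_space A)"
      using g by (simp add: nn_integral_eq_simple_integral)
    show "integral\<^sup>S (count_space A) g \<le> infsum f A"
    proof (cases "finite {x\<in>A. g x \<noteq> 0}")
      case True
      then have "(\<integral>\<^sup>+x. g x \<partial>count_space A) = sum g {x\<in>A. g x \<noteq> 0}"
        by (intro nn_integral_count_space') auto
      also have "\<dots> \<le> sum f {x\<in>A. g x \<noteq> 0}"
        by (intro sum_mono gf)
      also have "\<dots> = infsum f {x\<in>A. g x \<noteq> 0}"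
        using True by simp
      also have "\<dots> \<le> infsum f A"
        by (rule sub) auto
      finally show ?thesis using eq by simp
    next
      case False
      have "finite (g ` A)" using g by (simp add: simple_function_def)
      then obtain y where y: "y \<noteq> 0" "infinite {x\<in>A. g x = y}"
      proof -
        have "\<exists>z\<in>{x\<in>A. g x \<noteq> 0}. infinite {x \<in> {x\<in>A. g x \<noteq> 0}. g x = g z}"
          using False finite_subset[OF image_mono \<open>finite (g ` A)\<close>]
          by (intro pigeonhole_infinite) auto
        then obtain y where "y \<noteq> 0" "infinite {x \<in> {x\<in>A. g x \<noteq> 0}. g x = y}" by auto
        moreover have "{x \<in> {x\<in>A. g x \<noteq> 0}. g x = y} \<subseteq> {x\<in>A. g x = y}" by auto
        ultimately show ?thesis using that finite_subset by blast
      qed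
      have "infsum f {x\<in>A. g x = y} = \<infinity>"
        using y gf by (intro infsum_superconst_infinite_ennreal[of _ y]) (auto simp: zero_less_iff_neq_zero)
      then have "infsum f A = \<infinity>"
        using sub[of "{x\<in>A. g x = y}"] by (auto simp: top_unique)
      then show ?thesis by simp
    qed
  qed
qed

lemma nn_integral_count_space_Times:
  "(\<integral>\<^sup>+z. f z \<partial>count_space (A \<times> B)) =
   (\<integral>\<^sup>+x. \<integral>\<^sup>+y. f (x, y) \<partial>count_space B \<partial>count_space A)"
proof -
  have "(\<integral>\<^sup>+z. f z \<partial>count_space (A \<times> B)) = (\<integral>\<^sup>+z. f z * indicator (A \<times> B) z \<partial>count_space UNIV)"
    by (simp add: nn_integral_restrict_space[symmetric] restrict_count_space)
  also have "\<dots> = (\<integral>\<^sup>+x. \<integral>\<^sup>+y. f (x,y) * indicator (A \<times> B) (x,y) \<partial>count_space UNIV \<partial>count_space UNIV)"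
    by (rule nn_integral_fst_count_space[symmetric])
  also have "\<dots> = (\<integral>\<^sup>+x. (\<integral>\<^sup>+y. f (x,y) * indicator B y \<partial>count_space UNIV) * indicator A x \<partial>count_space UNIV)"
    by (intro nn_integral_cong) (auto simp: indicator_def)
  also have "\<dots> = (\<integral>\<^sup>+x. \<integral>\<^sup>+y. f (x, y) \<partial>count_space B \<partial>count_space A)"
    by (simp add: nn_integral_restrict_space[symmetric] restrict_count_space)
  finally show ?thesis .
qed

lemma nn_integral_count_space_pmf:
  assumes "set_pmf p \<subseteq> A"
  shows "(\<integral>\<^sup>+x. f x * ennreal (pmf p x) \<partial>count_space A) = (\<integral>\<^sup>+x. f x \<partial>measure_pmf p)"
proof -
  have "(\<integral>\<^sup>+x. f x * ennreal (pmf p x) \<partial>count_space A) = (\<integral>\<^sup>+x. f x * ennreal (pmf p x) \<partial>count_space UNIV)"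
    using assms by (intro nn_integral_count_space_eq) (auto simp: set_pmf_iff)
  then show ?thesis by (simp add: nn_integral_measure_pmf mult.commute)
qed


section \<open>Dirichlet forms and their elementary properties\<close>

lemma dirichlet_form_nn_integral:
  assumes "set_pmf \<phi> \<subseteq> carrier G"
  shows "dirichlet_form G \<phi> f =
    ennreal (1/2) * (\<integral>\<^sup>+x. \<integral>\<^sup>+y. ennreal ((f (x \<otimes>\<^bsub>G\<^esub> y) - f x)\<^sup>2) \<partial>\<phi> \<partial>count_space (carrier G))"
  unfolding dirichlet_form_def infsum_ennreal_eq_nn_integral nn_integral_count_space_Times
  using nn_integral_count_space_pmf[OF assms] by (simp add: ennreal_mult)

definition sq_norm :: "('a, 'c) monoid_scheme \<Rightarrow> ('a \<Rightarrow> real) \<Rightarrow> real" where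
  "sq_norm G f = (\<Sum>x\<in>supp_on G f. (f x)\<^sup>2)"

lemma sq_norm_nonneg [simp]: "0 \<le> sq_norm G f"
  by (simp add: sq_norm_def sum_nonneg)

lemma sq_norm_pos_iff:
  assumes "finite (supp_on G f)"
  shows "0 < sq_norm G f \<longleftrightarrow> supp_on G f \<noteq> {}"
proof -
  have "sq_norm G f = 0 \<longleftrightarrow> supp_on G f = {}"
    using assms by (subst sq_norm_def, subst sum_nonneg_eq_0_iff) (auto simp: supp_on_def)
  then show ?thesis using sq_norm_nonneg[of G f] by linarith
qed

lemma l2_norm_on_eq_sqrt_sq_norm:
  assumes "finite (supp_on G f)"
  shows "l2_norm_on G f = sqrt (sq_norm G f)"
proof -
  have "(\<Sum>\<^sub>\<infinity>x\<in>carrier G. (f x)\<^sup>2) = (\<Sum>\<^sub>\<infinity>x\<in>supp_on G f. (f x)\<^sup>2)"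
    by (intro infsum_cong_neutral) (auto simp: supp_on_def)
  then show ?thesis using assms by (simp add: l2_norm_on_def sq_norm_def)
qed

lemma ennreal_sq_norm_nn_integral:
  assumes "finite (supp_on G f)"
  shows "ennreal (sq_norm G f) = (\<integral>\<^sup>+x. ennreal ((f x)\<^sup>2) \<partial>count_space (carrier G))"
  using assms unfolding sq_norm_def
  by (subst nn_integral_count_space'[of "supp_on G f"]) (auto simp: supp_on_def)

text \<open>A contraction of the values does not increase the energy; this is used for truncations.\<close>

lemma dirichlet_form_mono:
  assumes "set_pmf \<phi> \<subseteq> carrier G" "group G"
  assumes "\<And>x y. x \<in> carrier G \<Longrightarrow> y \<in> carrier G \<Longrightarrow> \<bar>f x - f y\<bar> \<le> \<bar>g x - g y\<bar>"
  shows "dirichlet_form G \<phi> f \<le> dirichlet_form G \<phi> g"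
proof -
  interpret group G by fact
  show ?thesis
    unfolding dirichlet_form_nn_integral[OF assms(1)]
  proof (rule mult_left_mono, rule nn_integral_mono)
    fix x assume x: "x \<in> space (count_space (carrier G))"
    show "(\<integral>\<^sup>+y. ennreal ((f (x \<otimes>\<^bsub>G\<^esub> y) - f x)\<^sup>2) \<partial>\<phi>) \<le> (\<integral>\<^sup>+y. ennreal ((g (x \<otimes>\<^bsub>G\<^esub> y) - g x)\<^sup>2) \<partial>\<phi>)"
    proof (intro nn_integral_mono_AE AE_pmfI)
      fix y assume "y \<in> set_pmf \<phi>"
      then show "ennreal ((f (x \<otimes>\<^bsub>G\<^esub> y) - f x)\<^sup>2) \<le> ennreal ((g (x \<otimes>\<^bsub>G\<^esub> y) - g x)\<^sup>2)"
        using x assms(1) assms(3)[of "x \<otimes>\<^bsub>G\<^esub> y" x] by (intro ennreal_leI) (auto simp: abs_le_square_iff[symmetric])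
    qed
  qed auto
qed

lemma dirichlet_form_cong:
  assumes "set_pmf \<phi> \<subseteq> carrier G" "group G" "\<And>x. x \<in> carrier G \<Longrightarrow> f x = g x"
  shows "dirichlet_form G \<phi> f = dirichlet_form G \<phi> g"
  using assms by (intro antisym dirichlet_form_mono) auto

lemma dirichlet_form_scale:
  assumes "set_pmf \<phi> \<subseteq> carrier G"
  shows "dirichlet_form G \<phi> (\<lambda>x. c * f x) = ennreal (c\<^sup>2) * dirichlet_form G \<phi> f"
proof -
  have "ennreal ((c * a - c * b)\<^sup>2) = ennreal (c\<^sup>2) * ennreal ((a - b)\<^sup>2)" for a b :: real
    by (simp add: ennreal_mult[symmetric] power_mult_distrib[symmetric] algebra_simps)
  then show ?thesis
    unfolding dirichlet_form_nn_integral[OF assms]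
    by (simp add: nn_integral_cmult mult.left_commute)
qed


section \<open>Profiles and Rayleigh quotients\<close>

text \<open>The profile bounds Rayleigh quotients also of functions that are not normalised.  The product form
  covers \<open>f = 0\<close>, since \<open>\<infinity> \<cdot> 0 = 0\<close>.\<close>

lemma l2_profile_le_rayleigh:
  assumes "set_pmf \<phi> \<subseteq> carrier G" "finite (supp_on G f)" "real (card (supp_on G f)) \<le> v"
  shows "l2_profile G \<phi> v * ennreal (sq_norm G f) \<le> dirichlet_form G \<phi> f"
proof (cases "supp_on G f = {}")
  case True
  then show ?thesis by (simp add: sq_norm_def)
next
  case False
  define N where "N = sqrt (sq_norm G f)"
  have N: "N > 0" "N\<^sup>2 = sq_norm G f"
    using False sq_norm_pos_iff[OF assms(2)] by (auto simp: N_def)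
  define g where "g = (\<lambda>x. (1 / N) * f x)"
  have sg: "supp_on G g = supp_on G f" using N by (auto simp: supp_on_def g_def)
  have "sq_norm G g = sq_norm G f / N\<^sup>2"
    unfolding sq_norm_def sg by (simp add: g_def power_divide sum_divide_distrib)
  then have "sq_norm G g = 1" using N by (metis divide_self_if power_not_zero less_numeral_extra(3))
  then have "l2_profile G \<phi> v \<le> dirichlet_form G \<phi> g"
    unfolding l2_profile_def using assms by (intro INF_lower) (simp add: sg l2_norm_on_eq_sqrt_sq_norm)
  also have "\<dots> = ennreal ((1/N)\<^sup>2) * dirichlet_form G \<phi> f"
    unfolding g_def using assms(1) by (rule dirichlet_form_scale)
  finally have "l2_profile G \<phi> v * ennreal (N\<^sup>2) \<le> ennreal ((1/N)\<^sup>2) * dirichlet_form G \<phi> f * ennreal (N\<^sup>2)"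
    by (rule mult_right_mono) simp
  also have "\<dots> = dirichlet_form G \<phi> f * (ennreal ((1/N)\<^sup>2) * ennreal (N\<^sup>2))"
    by (simp add: ac_simps)
  also have "ennreal ((1/N)\<^sup>2) * ennreal (N\<^sup>2) = ennreal ((1/N * N)\<^sup>2)"
    by (simp only: ennreal_mult[symmetric] power_mult_distrib zero_le_power2)
  also have "\<dots> = 1"
    using N by simp
  finally show ?thesis by (simp add: N)
qed

lemma l2_profile_floor: "l2_profile G \<phi> v = l2_profile G \<phi> (real_of_int \<lfloor>v\<rfloor>)"
proof -
  have iff: "(real n \<le> v) = (real n \<le> real_of_int \<lfloor>v\<rfloor>)" for n
    using le_floor_iff[of "int n" v] by linarith
  have "{f. finite (supp_on G f) \<and> real (card (supp_on G f)) \<le> v \<and> l2_norm_on G f = 1} =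
    {f. finite (supp_on G f) \<and> real (card (supp_on G f)) \<le> real_of_int \<lfloor>v\<rfloor> \<and> l2_norm_on G f = 1}"
    by (rule Collect_cong, rule conj_cong[OF refl conj_cong[OF iff refl]])
  then show ?thesis
    unfolding l2_profile_def by (simp only:)
qed

lemma l2_profile_eq_top:
  assumes "v < 1"
  shows "l2_profile G \<phi> v = \<infinity>"
proof -
  have False if "finite (supp_on G f)" "real (card (supp_on G f)) \<le> v" "l2_norm_on G f = 1" for f
  proof -
    have "card (supp_on G f) = 0" using that(2) assms by linarith
    then have "supp_on G f = {}" using that(1) by simp
    then show False using that(1,3) by (simp add: l2_norm_on_eq_sqrt_sq_norm sq_norm_def)
  qed
  then have "{f. finite (supp_on G f) \<and> real (card (supp_on G f)) \<le> v \<and> l2_norm_on G f = 1} = {}"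
    by blast
  then show ?thesis unfolding l2_profile_def by (simp only: image_empty) simp
qed

text \<open>The profile is a step function that jumps only at integers.  So when its generalised inverse is
  finite, the infimum is attained, at a positive integer.\<close>

lemma l2_profile_inv_cases:
  obtains (infinite) "l2_profile_inv G \<phi> s = \<infinity>" "\<And>v. ennreal s < l2_profile G \<phi> v"
  | (finite) n where "1 \<le> n" "l2_profile_inv G \<phi> s = of_nat n" "l2_profile G \<phi> (real n) \<le> ennreal s"
      "\<And>v. v < real n \<Longrightarrow> ennreal s < l2_profile G \<phi> v"
proof (cases "\<exists>n. l2_profile G \<phi> (real n) \<le> ennreal s")
  case True
  define n where "n = (LEAST n. l2_profile G \<phi> (real n) \<le> ennreal s)"
  have n: "l2_profile G \<phi> (real n) \<le> ennreal s"
    unfolding n_def using True by (rule LeastI_ex)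
  have "n \<noteq> 0"
  proof
    assume "n = 0"
    then have "(\<infinity>::ennreal) \<le> ennreal s" using n l2_profile_eq_top[of 0 G \<phi>] by simp
    then show False by (simp add: top_unique)
  qed
  have less: "ennreal s < l2_profile G \<phi> v" if v: "v < real n" for v
  proof (cases "v < 1")
    case True
    then show ?thesis by (simp add: l2_profile_eq_top)
  next
    case False
    then have "real_of_int \<lfloor>v\<rfloor> = real (nat \<lfloor>v\<rfloor>)" by simp
    moreover have "nat \<lfloor>v\<rfloor> < n" using v False by linarith
    ultimately show ?thesis
      using not_less_Least[of "nat \<lfloor>v\<rfloor>" "\<lambda>n. l2_profile G \<phi> (real n) \<le> ennreal s"]
        l2_profile_floor[of G \<phi> v] by (metis n_def not_le)
  qed
  have "l2_profile_inv G \<phi> s = of_nat n"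
    unfolding l2_profile_inv_def
  proof (rule antisym)
    show "(INF v\<in>{v. 0 < v \<and> l2_profile G \<phi> v \<le> ennreal s}. ennreal v) \<le> of_nat n"
      using n \<open>n \<noteq> 0\<close> by (intro INF_lower2[of "real n"]) (auto simp: ennreal_of_nat_eq_real_of_nat)
    show "of_nat n \<le> (INF v\<in>{v. 0 < v \<and> l2_profile G \<phi> v \<le> ennreal s}. ennreal v)"
      proof (rule INF_greatest)
      fix v assume "v \<in> {v. 0 < v \<and> l2_profile G \<phi> v \<le> ennreal s}"
      then have "\<not> v < real n" using less[of v] by auto
      then show "of_nat n \<le> ennreal v"
        unfolding ennreal_of_nat_eq_real_of_nat by (intro ennreal_leI) simp
    qed
  qed
  then show ?thesis using n less \<open>n \<noteq> 0\<close> by (intro that(2)[of n]) auto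
next
  case False
  have gt: "ennreal s < l2_profile G \<phi> v" for v
  proof (cases "v < 1")
    case True
    then show ?thesis by (simp add: l2_profile_eq_top)
  next
    case v: False
    then have "real_of_int \<lfloor>v\<rfloor> = real (nat \<lfloor>v\<rfloor>)" by simp
    then show ?thesis using False l2_profile_floor[of G \<phi> v] by (metis not_le)
  qed
  then have "{v. 0 < v \<and> l2_profile G \<phi> v \<le> ennreal s} = {}" by (auto simp: not_le)
  then have "l2_profile_inv G \<phi> s = \<infinity>" unfolding l2_profile_inv_def by (simp only: image_empty) simp
  then show ?thesis using gt by (rule that(1))
qed

text \<open>The form in which the hypothesis on the profiles enters the lower bound: below \<open>b\<close> points of
  support, Rayleigh quotients are at least \<open>s\<close>.\<close>

lemma gap_of_profile:
  assumes \<phi>: "set_pmf \<phi> \<subseteq> carrier G" and s: "0 < s"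
    and gt: "\<And>v. v < real b \<Longrightarrow> ennreal s < l2_profile G \<phi> v"
    and u: "finite (supp_on G u)" "card (supp_on G u) < b"
  shows "ennreal (s * sq_norm G u) \<le> dirichlet_form G \<phi> u"
proof -
  have "ennreal (s * sq_norm G u) = ennreal s * ennreal (sq_norm G u)"
    using s by (simp add: ennreal_mult)
  also have "\<dots> \<le> l2_profile G \<phi> (real (card (supp_on G u))) * ennreal (sq_norm G u)"
    using gt[of "real (card (supp_on G u))"] u(2) by (intro mult_right_mono) auto
  also have "\<dots> \<le> dirichlet_form G \<phi> u"
    using \<phi> u(1) by (rule l2_profile_le_rayleigh) simp
  finally show ?thesis .
qed


section \<open>Superlevel sets of functions of small energy\<close>

text \<open>Both sums are total lengths of families of intervals, \<open>(0, w x)\<close> and \<open>[l y, r y)\<close>, so they are the integrals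
  over \<open>t\<close> of the numbers of intervals that contain \<open>t\<close>.\<close>

lemma layer_cake:
  fixes w :: "'a \<Rightarrow> real" and l r :: "'b \<Rightarrow> real"
  assumes fin: "finite A" "finite B" and w: "\<And>x. x \<in> A \<Longrightarrow> 0 \<le> w x" and c: "0 \<le> c"
    and le: "\<And>t. 0 < t \<Longrightarrow> c * real (card {x\<in>A. t < w x}) \<le> real (card {y\<in>B. l y \<le> t \<and> t < r y})"
  shows "c * (\<Sum>x\<in>A. w x) \<le> (\<Sum>y\<in>B. max 0 (r y - l y))"
proof -
  have "ennreal c * (\<Sum>x\<in>A. indicator {0<..<w x} t) \<le> (\<Sum>y\<in>B. indicator {l y..<r y} t :: ennreal)" for t
  proof (cases "0 < t")
    case True
    have "(\<Sum>x\<in>A. indicator {0<..<w x} t :: ennreal) = of_nat (card {x\<in>A. t < w x})"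
      using fin True by (simp add: indicator_def of_bool_def sum.If_cases Int_def)
    moreover have "(\<Sum>y\<in>B. indicator {l y..<r y} t :: ennreal) = of_nat (card {y\<in>B. l y \<le> t \<and> t < r y})"
      using fin by (simp add: indicator_def of_bool_def sum.If_cases Int_def)
    ultimately show ?thesis
      using le[OF True] c by (simp add: ennreal_of_nat_eq_real_of_nat ennreal_mult[symmetric])
  next
    case False
    then show ?thesis by simp
  qed
  then have "(\<integral>\<^sup>+t. ennreal c * (\<Sum>x\<in>A. indicator {0<..<w x} t) \<partial>lborel)
      \<le> (\<integral>\<^sup>+t. (\<Sum>y\<in>B. indicator {l y..<r y} t) \<partial>lborel)"
    by (intro nn_integral_mono) simp
  also have "(\<integral>\<^sup>+t. ennreal c * (\<Sum>x\<in>A. indicator {0<..<w x} t) \<partial>lborel) = ennreal c * (\<Sum>x\<in>A. ennreal (w x))"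
    using w by (subst nn_integral_cmult) (auto simp: nn_integral_sum intro!: sum.cong)
  also have "(\<integral>\<^sup>+t. (\<Sum>y\<in>B. indicator {l y..<r y} t) \<partial>lborel) = (\<Sum>y\<in>B. ennreal (max 0 (r y - l y)))"
  proof (subst nn_integral_sum)
    have "emeasure lborel {l y..<r y} = ennreal (max 0 (r y - l y))" for y
      by (cases "l y \<le> r y") (auto simp: max_def)
    then show "(\<Sum>y\<in>B. \<integral>\<^sup>+t. indicator {l y..<r y} t \<partial>lborel) = (\<Sum>y\<in>B. ennreal (max 0 (r y - l y)))"
      by simp
  qed simp
  also have "(\<Sum>y\<in>B. ennreal (max 0 (r y - l y))) = ennreal (\<Sum>y\<in>B. max 0 (r y - l y))"
    by (rule sum_ennreal) simp
  also have "ennreal c * (\<Sum>x\<in>A. ennreal (w x)) = ennreal (c * (\<Sum>x\<in>A. w x))"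
    using w c by (simp add: sum_nonneg ennreal_mult)
  finally have "ennreal (c * (\<Sum>x\<in>A. w x)) \<le> ennreal (\<Sum>y\<in>B. max 0 (r y - l y))" .
  then show ?thesis by (subst (asm) ennreal_le_iff) (auto intro: sum_nonneg)
qed


text \<open>If the parts of \<open>w\<close> above the thresholds \<open>\<tau>1\<close> and \<open>\<tau>2\<close> carry little of the total mass, then at some level
  \<open>t\<close> few points of the superlevel set are past one of their thresholds.  With \<open>\<tau>1 x\<close> and \<open>\<tau>2 x\<close> the levels at
  which the two lines through \<open>x\<close> become poor, the points counted on the left include all those on
  poor lines.\<close>

lemma exists_level:
  fixes w \<tau>1 \<tau>2 :: "'a \<Rightarrow> real"
  assumes fin: "finite \<Omega>" and w: "\<And>x. x \<in> \<Omega> \<Longrightarrow> 0 \<le> w x"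
    and small: "(\<Sum>x\<in>\<Omega>. max 0 (w x - \<tau>1 x)) + (\<Sum>x\<in>\<Omega>. max 0 (w x - \<tau>2 x)) < (\<Sum>x\<in>\<Omega>. w x) / 4"
  obtains t where "0 < t"
    "4 * (card {x\<in>\<Omega>. \<tau>1 x \<le> t \<and> t < w x} + card {x\<in>\<Omega>. \<tau>2 x \<le> t \<and> t < w x}) < card {x\<in>\<Omega>. t < w x}"
proof (rule ccontr)
  assume no: "\<not> thesis"
  let ?l = "case_sum \<tau>1 \<tau>2" and ?r = "case_sum w w"
  have "1/4 * (\<Sum>x\<in>\<Omega>. w x) \<le> (\<Sum>y\<in>\<Omega> <+> \<Omega>. max 0 (?r y - ?l y))"
  proof (rule layer_cake)
    fix t :: real assume t: "0 < t"
    have "{y\<in>\<Omega> <+> \<Omega>. ?l y \<le> t \<and> t < ?r y} =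
        {x\<in>\<Omega>. \<tau>1 x \<le> t \<and> t < w x} <+> {x\<in>\<Omega>. \<tau>2 x \<le> t \<and> t < w x}"
      by auto
    moreover have "card {x\<in>\<Omega>. t < w x} \<le> 4 * (card {x\<in>\<Omega>. \<tau>1 x \<le> t \<and> t < w x} + card {x\<in>\<Omega>. \<tau>2 x \<le> t \<and> t < w x})"
      using no that[OF t] by (meson not_le)
    ultimately show "1/4 * real (card {x\<in>\<Omega>. t < w x}) \<le> real (card {y\<in>\<Omega> <+> \<Omega>. ?l y \<le> t \<and> t < ?r y})"
      using fin by (simp add: card_Plus)
  qed (use fin w in auto)
  then show False using small fin by (simp add: sum.Plus)
qed


text \<open>The number \<open>t0\<close> is the least level above which \<open>g\<^sup>2\<close> has fewer than \<open>b\<close> points, that is, the \<open>b\<close>-th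
  largest value of \<open>g\<^sup>2\<close>, or 0 if there are fewer than \<open>b\<close> points.  The truncation \<open>u = max 0 (\<bar>g\<bar> - \<surd>t0)\<close> has fewer than \<open>b\<close> points of support, so
  the gap bounds its norm by its energy, which is at most that of \<open>g\<close>.  Where \<open>g\<^sup>2 > t0\<close>, the
  arithmetic-geometric mean inequality gives \<open>g\<^sup>2 - t0 = u\<^sup>2 + 2 u \<surd>t0 \<le> 17 u\<^sup>2 + t0 / 16\<close>.  The bound is
  linear in the energy and in the mass of \<open>g\<close>, so it can be summed over lines.\<close>

lemma level_threshold:
  fixes G (structure) and g :: "'a \<Rightarrow> real"
  assumes G: "group G" "set_pmf \<phi> \<subseteq> carrier G" and fin: "finite (supp_on G g)" and s: "0 < s" and b: "1 \<le> b"
    and gap: "\<And>u. finite (supp_on G u) \<Longrightarrow> card (supp_on G u) < b \<Longrightarrow>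
      ennreal (s * sq_norm G u) \<le> dirichlet_form G \<phi> u"
  obtains t0 where "0 \<le> t0"
    "\<And>t. 0 \<le> t \<Longrightarrow> card {x\<in>carrier G. t < (g x)\<^sup>2} < b \<Longrightarrow> t0 \<le> t"
    "ennreal (\<Sum>x\<in>supp_on G g. max 0 ((g x)\<^sup>2 - t0)) \<le>
       ennreal (17 / s) * dirichlet_form G \<phi> g + ennreal (sq_norm G g / 16)"
proof -
  \<comment> \<open>Only the values of \<open>g\<^sup>2\<close>, together with 0, matter as levels, so \<open>t0\<close> is a minimum over a finite set.\<close>
  define T where "T = insert 0 ((\<lambda>x. (g x)\<^sup>2) ` supp_on G g)"
  define N where "N t = card {x\<in>carrier G. t < (g x)\<^sup>2}" for t
  have T: "finite T" "\<And>t. t \<in> T \<Longrightarrow> 0 \<le> t" using fin by (auto simp: T_def)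
  have inT: "(g x)\<^sup>2 \<in> T" if "x \<in> carrier G" for x
    using that by (cases "g x = 0") (auto simp: T_def supp_on_def)
  have "{x\<in>carrier G. Max T < (g x)\<^sup>2} = {}"
    using Max_ge[OF T(1) inT] by (auto simp: not_less)
  then have "N (Max T) = 0" unfolding N_def by (simp only: card.empty)
  moreover have "Max T \<in> T" using T(1) by (intro Max_in) (simp_all add: T_def)
  ultimately have "Max T \<in> {t\<in>T. N t < b}" using b by simp
  then have ne: "{t\<in>T. N t < b} \<noteq> {}" by blast
  define t0 where "t0 = Min {t\<in>T. N t < b}"
  have t0: "t0 \<in> T" "N t0 < b" using Min_in[OF _ ne] T(1) by (auto simp: t0_def)
  have t0_le: "t0 \<le> t" if "0 \<le> t" "N t < b" for t
  proof -
    define t' where "t' = Max {r\<in>T. r \<le> t}"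
    have "{r\<in>T. r \<le> t} \<noteq> {}" using that by (auto simp: T_def)
    then have t': "t' \<in> T" "t' \<le> t" using Max_in[of "{r\<in>T. r \<le> t}"] T(1) by (auto simp: t'_def)
    have "t' < (g x)\<^sup>2 \<longleftrightarrow> t < (g x)\<^sup>2" if "x \<in> carrier G" for x
    proof -
      have "(g x)\<^sup>2 \<le> t \<Longrightarrow> (g x)\<^sup>2 \<le> t'"
        unfolding t'_def using T(1) inT[OF that] by (intro Max_ge) auto
      then show ?thesis using t'(2) by linarith
    qed
    then have "{x\<in>carrier G. t' < (g x)\<^sup>2} = {x\<in>carrier G. t < (g x)\<^sup>2}" by blast
    then have "N t' = N t" by (simp only: N_def)
    then have "t0 \<le> t'" unfolding t0_def using that t'(1) T(1) by (intro Min_le) auto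
    then show ?thesis using t'(2) by simp
  qed
  have t0_nn: "0 \<le> t0" using t0 T by blast
  define u where "u x = max 0 (\<bar>g x\<bar> - sqrt t0)" for x
  have pos: "sqrt t0 < \<bar>g x\<bar> \<longleftrightarrow> t0 < (g x)\<^sup>2" for x
    using real_sqrt_less_iff[of t0 "(g x)\<^sup>2"] by simp
  have su: "supp_on G u = {x\<in>carrier G. t0 < (g x)\<^sup>2}"
  proof -
    have "u x \<noteq> 0 \<longleftrightarrow> sqrt t0 < \<bar>g x\<bar>" for x by (auto simp: u_def max_def)
    then show ?thesis using pos by (simp add: supp_on_def)
  qed
  have sub: "supp_on G u \<subseteq> supp_on G g" using t0_nn unfolding su by (auto simp: supp_on_def)
  have "ennreal (s * sq_norm G u) \<le> dirichlet_form G \<phi> u"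
    using finite_subset[OF sub fin] t0(2) by (intro gap) (auto simp: su N_def)
  also have "\<dots> \<le> dirichlet_form G \<phi> g"
    using G by (intro dirichlet_form_mono) (auto simp: u_def)
  finally have E: "ennreal (s * sq_norm G u) \<le> dirichlet_form G \<phi> g" .
  \<comment> \<open>The square below is the arithmetic-geometric mean inequality with weights that leave only a
    sixteenth of \<open>t0\<close>.\<close>
  have pt: "max 0 ((g x)\<^sup>2 - t0) \<le> 17 * (u x)\<^sup>2 + (g x)\<^sup>2 / 16" for x
  proof (cases "t0 < (g x)\<^sup>2")
    case False
    then show ?thesis by (simp add: max_def)
  next
    case True
    then have ux: "u x = \<bar>g x\<bar> - sqrt t0" using pos[of x] by (simp add: u_def)
    have "(g x)\<^sup>2 = (u x + sqrt t0)\<^sup>2" by (simp add: ux)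
    then have "(g x)\<^sup>2 - t0 = (u x)\<^sup>2 + 2 * u x * sqrt t0"
      using t0_nn by (simp add: power2_sum)
    moreover have "0 \<le> (4 * u x - sqrt t0 / 4)\<^sup>2" by simp
    then have "2 * u x * sqrt t0 \<le> 16 * (u x)\<^sup>2 + t0 / 16"
      using t0_nn by (simp add: power2_diff power_mult_distrib power_divide mult.commute mult.left_commute)
    ultimately show ?thesis using True by (simp add: max_def)
  qed
  have "(\<Sum>x\<in>supp_on G g. max 0 ((g x)\<^sup>2 - t0)) \<le> (\<Sum>x\<in>supp_on G g. 17 * (u x)\<^sup>2 + (g x)\<^sup>2 / 16)"
    by (intro sum_mono pt)
  also have "\<dots> = 17 * (\<Sum>x\<in>supp_on G g. (u x)\<^sup>2) + sq_norm G g / 16"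
    by (simp add: sum.distrib sum_distrib_left sum_divide_distrib sq_norm_def)
  also have "(\<Sum>x\<in>supp_on G g. (u x)\<^sup>2) = sq_norm G u"
    unfolding sq_norm_def using fin sub by (intro sum.mono_neutral_right) (auto simp: supp_on_def)
  finally have "ennreal (\<Sum>x\<in>supp_on G g. max 0 ((g x)\<^sup>2 - t0)) \<le> ennreal (17 / s * (s * sq_norm G u) + sq_norm G g / 16)"
    using s by (intro ennreal_leI) simp
  also have "\<dots> = ennreal (17 / s) * ennreal (s * sq_norm G u) + ennreal (sq_norm G g / 16)"
    using s by (simp add: ennreal_mult[symmetric] ennreal_plus[symmetric] del: ennreal_plus)
  also have "\<dots> \<le> ennreal (17 / s) * dirichlet_form G \<phi> g + ennreal (sq_norm G g / 16)"
    using E by (intro add_right_mono mult_left_mono) auto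
  finally show ?thesis using that[of t0] t0_nn t0_le by (simp add: N_def)
qed

section \<open>Subsets that are thick along lines\<close>

text \<open>The fibres of \<open>p\<close> and of \<open>q\<close> are two families of lines in \<open>\<Omega>\<close>, and \<open>few\<close> says that few points lie on
  lines that are too short.  Consider the potential \<open>4 |S| - 2 a |p S| - b |q S|\<close>.  It is positive for the set of
  points that lie on no short line: these are more than three quarters of \<open>\<Omega>\<close>, and long lines are few, at most \<open>|\<Omega>| / a\<close> and \<open>|\<Omega>| / b\<close>.  Take \<open>S\<close> of minimal size
  with positive potential.  Removing a \<open>p\<close>-line with \<open>m\<close> points of \<open>S\<close> changes the potential by at least
  \<open>2 a - 4 m\<close>, so minimality forces \<open>a < 2 m\<close>, and likewise for \<open>q\<close>-lines.  The strict inequality matters: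
  for \<open>a = 2\<close> it still leaves two points on each line.\<close>

lemma thick_subset:
  fixes p :: "'a \<Rightarrow> 'b" and q :: "'a \<Rightarrow> 'c" and a b :: nat
  assumes fin: "finite \<Omega>"
    and few: "4 * (card {x\<in>\<Omega>. card {y\<in>\<Omega>. p y = p x} < a} + card {x\<in>\<Omega>. card {y\<in>\<Omega>. q y = q x} < b}) < card \<Omega>"
  obtains S where "S \<subseteq> \<Omega>" "S \<noteq> {}" "\<And>x. x \<in> S \<Longrightarrow> a < 2 * card {y\<in>S. p y = p x}"
    "\<And>x. x \<in> S \<Longrightarrow> b < 4 * card {y\<in>S. q y = q x}"
proof -
  define \<Phi> where "\<Phi> S = 4 * int (card S) - 2 * (int a * int (card (p ` S))) - int b * int (card (q ` S))" for S
  have lines: "n * card (g ` G) \<le> card \<Omega>"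
    if "G \<subseteq> \<Omega>" "\<And>x. x \<in> G \<Longrightarrow> n \<le> card {y\<in>\<Omega>. g y = g x}" for G n and g :: "'a \<Rightarrow> 'd"
  proof -
    have "n * card (g ` G) \<le> (\<Sum>l\<in>g ` G. card {y\<in>\<Omega>. g y = l})"
      using sum_mono[of "g ` G" "\<lambda>_. n" "\<lambda>l. card {y\<in>\<Omega>. g y = l}"] that(2) by (auto simp: mult.commute)
    also have "\<dots> = card (\<Union>l\<in>g ` G. {y\<in>\<Omega>. g y = l})"
      using fin finite_subset[OF that(1) fin] by (subst card_UN_disjoint) auto
    also have "\<dots> \<le> card \<Omega>" using fin by (intro card_mono) auto
    finally show ?thesis .
  qed
  define B1 where "B1 = {x\<in>\<Omega>. card {y\<in>\<Omega>. p y = p x} < a}"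
  define B2 where "B2 = {x\<in>\<Omega>. card {y\<in>\<Omega>. q y = q x} < b}"
  define G where "G = \<Omega> - (B1 \<union> B2)"
  have "card \<Omega> \<le> card (G \<union> (B1 \<union> B2))"
    using fin by (intro card_mono) (auto simp: G_def B1_def B2_def)
  then have "card \<Omega> \<le> card G + (card B1 + card B2)"
    by (meson card_Un_le le_trans add_left_mono)
  moreover have "4 * (card B1 + card B2) < card \<Omega>" using few by (simp add: B1_def B2_def)
  ultimately have "3 * card \<Omega> < 4 * card G" by presburger
  then have "3 * int (card \<Omega>) < 4 * int (card G)" by linarith
  moreover have "int a * int (card (p ` G)) \<le> int (card \<Omega>)" "int b * int (card (q ` G)) \<le> int (card \<Omega>)"
    unfolding of_nat_mult[symmetric] of_nat_le_iff by (rule lines; auto simp: G_def B1_def B2_def)+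
  ultimately have "0 < 4 * int (card G) - 2 * (int a * int (card (p ` G))) - int b * int (card (q ` G))"
    by linarith
  then have "\<Phi> G > 0" unfolding \<Phi>_def by simp
  then have ex: "\<exists>n. \<exists>S\<subseteq>\<Omega>. \<Phi> S > 0 \<and> card S = n" by (auto simp: G_def)
  define n where "n = (LEAST n. \<exists>S\<subseteq>\<Omega>. \<Phi> S > 0 \<and> card S = n)"
  obtain S where S: "S \<subseteq> \<Omega>" "\<Phi> S > 0" "card S = n"
    using LeastI_ex[OF ex] unfolding n_def by blast
  have finS: "finite S" using S fin finite_subset by blast
  have minimal: "\<Phi> S' \<le> 0" if "S' \<subset> S" for S'
  proof (rule ccontr)
    assume "\<not> \<Phi> S' \<le> 0"
    then have "n \<le> card S'"
      unfolding n_def using that S(1) by (intro Least_le) (auto intro!: exI[of _ S'])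
    then show False using psubset_card_mono[OF finS that] S(3) by simp
  qed
  have removal: "card S = card {y\<in>S. g y = g x} + card (S - {y\<in>S. g y = g x})"
      "card (g ` S) = card (g ` (S - {y\<in>S. g y = g x})) + 1"
      "S - {y\<in>S. g y = g x} \<subset> S"
    if "x \<in> S" for x and g :: "'a \<Rightarrow> 'd"
  proof -
    show "card S = card {y\<in>S. g y = g x} + card (S - {y\<in>S. g y = g x})"
      using finS by (subst card_Un_disjoint[symmetric]) (auto intro: arg_cong[where f=card])
    have "g ` S = insert (g x) (g ` (S - {y\<in>S. g y = g x}))" using that by auto
    moreover have "g x \<notin> g ` (S - {y\<in>S. g y = g x})" by auto
    ultimately show "card (g ` S) = card (g ` (S - {y\<in>S. g y = g x})) + 1"
      using finS by simp
    show "S - {y\<in>S. g y = g x} \<subset> S" using that by auto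
  qed
  show ?thesis
  proof (rule that[OF S(1)])
    show "S \<noteq> {}" using S(2) by (auto simp: \<Phi>_def)
  next
    fix x assume x: "x \<in> S"
    let ?R = "S - {y\<in>S. p y = p x}"
    note r = removal[OF x, of p]
    have "card (q ` ?R) \<le> card (q ` S)" using finS by (intro card_mono) auto
    then have "int b * int (card (q ` ?R)) \<le> int b * int (card (q ` S))" by (intro mult_left_mono) auto
    moreover have "2 * (int a * int (card (p ` S))) = 2 * (int a * int (card (p ` ?R))) + 2 * int a"
      using r(2) by (simp add: algebra_simps)
    ultimately show "a < 2 * card {y\<in>S. p y = p x}"
      using S(2) minimal[OF r(3)] r(1) unfolding \<Phi>_def by linarith
  next
    fix x assume x: "x \<in> S"
    let ?R = "S - {y\<in>S. q y = q x}"
    note r = removal[OF x, of q]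
    have "card (p ` ?R) \<le> card (p ` S)" using finS by (intro card_mono) auto
    then have "2 * (int a * int (card (p ` ?R))) \<le> 2 * (int a * int (card (p ` S)))" by (intro mult_left_mono) auto
    moreover have "int b * int (card (q ` S)) = int b * int (card (q ` ?R)) + int b"
      using r(2) by (simp add: algebra_simps)
    ultimately show "b < 4 * card {y\<in>S. q y = q x}"
      using S(2) minimal[OF r(3)] r(1) unfolding \<Phi>_def by linarith
  qed
qed

text \<open>Fix an element \<open>f\<close> and one of its coordinates \<open>h\<close> with many variations.  The elements of \<open>U\<close> are sorted by
  their value at \<open>h\<close>; at least \<open>m\<close> of the classes are nonempty, and each of these satisfies the
  hypothesis with one coordinate less, because variations in other coordinates stay in the class.\<close>

lemma card_ge_power_of_variations:
  fixes U :: "('b \<Rightarrow> 'a) set"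
  assumes "finite U" "U \<noteq> {}"
    and "\<And>f. f \<in> U \<Longrightarrow> \<exists>D. finite D \<and> n \<le> card D \<and> (\<forall>h\<in>D. m \<le> card {f'\<in>U. \<forall>x. x \<noteq> h \<longrightarrow> f' x = f x})"
  shows "m ^ n \<le> card U"
  using assms
proof (induction n arbitrary: U)
  case 0
  then show ?case by (simp add: Suc_leI card_gt_0_iff)
next
  case (Suc n)
  obtain f where f: "f \<in> U" using Suc.prems by blast
  obtain D where D: "finite D" "Suc n \<le> card D" "\<And>h. h \<in> D \<Longrightarrow> m \<le> card {f'\<in>U. \<forall>x. x \<noteq> h \<longrightarrow> f' x = f x}"
    using Suc.prems(3)[OF f] by blast
  obtain h where h: "h \<in> D" using D(2) by fastforce
  define V where "V = {f'\<in>U. \<forall>x. x \<noteq> h \<longrightarrow> f' x = f x}"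
  have "inj_on (\<lambda>f'. f' h) V"
  proof (rule inj_onI)
    fix f1 f2 assume "f1 \<in> V" "f2 \<in> V" "f1 h = f2 h"
    then have "f1 x = f2 x" for x by (cases "x = h") (auto simp: V_def)
    then show "f1 = f2" by blast
  qed
  then have K: "m \<le> card ((\<lambda>f'. f' h) ` V)" using D(3)[OF h] by (simp add: card_image V_def)
  have slice: "m ^ n \<le> card {f'\<in>U. f' h = k}" if "k \<in> (\<lambda>f'. f' h) ` V" for k
  proof (rule Suc.IH)
    show "finite {f'\<in>U. f' h = k}" using Suc.prems by simp
    show "{f'\<in>U. f' h = k} \<noteq> {}" using that by (auto simp: V_def)
    fix f1 assume f1: "f1 \<in> {f'\<in>U. f' h = k}"
    then obtain D' where D': "finite D'" "Suc n \<le> card D'"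
      "\<And>h. h \<in> D' \<Longrightarrow> m \<le> card {f'\<in>U. \<forall>x. x \<noteq> h \<longrightarrow> f' x = f1 x}"
      using Suc.prems(3)[of f1] by blast
    have "{f'\<in>{f'\<in>U. f' h = k}. \<forall>x. x \<noteq> h' \<longrightarrow> f' x = f1 x} = {f'\<in>U. \<forall>x. x \<noteq> h' \<longrightarrow> f' x = f1 x}"
      if "h' \<in> D' - {h}" for h'
      using f1 that by auto
    moreover have "n \<le> card (D' - {h})" using D'(1,2) by (cases "h \<in> D'") auto
    ultimately show "\<exists>D. finite D \<and> n \<le> card D \<and>
        (\<forall>h'\<in>D. m \<le> card {f'\<in>{f'\<in>U. f' h = k}. \<forall>x. x \<noteq> h' \<longrightarrow> f' x = f1 x})"
      using D' by (intro exI[of _ "D' - {h}"]) auto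
  qed
  have "m ^ Suc n \<le> card ((\<lambda>f'. f' h) ` V) * m ^ n" using K by simp
  also have "\<dots> \<le> (\<Sum>k\<in>(\<lambda>f'. f' h) ` V. card {f'\<in>U. f' h = k})"
    using sum_mono[OF slice] by simp
  also have "\<dots> = card (\<Union>k\<in>(\<lambda>f'. f' h) ` V. {f'\<in>U. f' h = k})"
    using Suc.prems(1) by (subst card_UN_disjoint) (auto simp: V_def)
  also have "\<dots> \<le> card U" using Suc.prems(1) by (intro card_mono) auto
  finally show ?case .
qed


section \<open>Dirichlet forms along the lines of a fibration\<close>

text \<open>A partition of \<open>E\<close> into lines, indexed by \<open>Lines\<close>, each of which is parametrised by the group \<open>G\<close>.\<close>

locale fibration = group G for G (structure) +
  fixes E :: "'x set" and Lines :: "'l set" and \<iota> :: "'l \<Rightarrow> 'a \<Rightarrow> 'x" and p :: "'x \<Rightarrow> 'l"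
  assumes bij: "bij_betw (\<lambda>(l, k). \<iota> l k) (Lines \<times> carrier G) E"
    and p: "l \<in> Lines \<Longrightarrow> k \<in> carrier G \<Longrightarrow> p (\<iota> l k) = l"
begin

lemma nn_integral_slices:
  "(\<integral>\<^sup>+x. \<Phi> x \<partial>count_space E) = (\<integral>\<^sup>+l. \<integral>\<^sup>+k. \<Phi> (\<iota> l k) \<partial>count_space (carrier G) \<partial>count_space Lines)"
  using nn_integral_bij_count_space[OF bij, of \<Phi>] by (simp add: nn_integral_count_space_Times)

lemma in_E: "l \<in> Lines \<Longrightarrow> k \<in> carrier G \<Longrightarrow> \<iota> l k \<in> E"
  using bij by (auto simp: bij_betw_def)

lemma E_cases:
  assumes "x \<in> E" obtains k where "p x \<in> Lines" "k \<in> carrier G" "x = \<iota> (p x) k"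
proof -
  obtain l k where "l \<in> Lines" "k \<in> carrier G" "x = \<iota> l k"
    using assms bij by (auto simp: bij_betw_def)
  then show ?thesis using that p by auto
qed

lemma p_in: "x \<in> E \<Longrightarrow> p x \<in> Lines"
  by (rule E_cases)

lemma inj_slice: "l \<in> Lines \<Longrightarrow> inj_on (\<iota> l) (carrier G)"
  using bij by (auto simp: bij_betw_def inj_on_def)

lemma finite_supp_slice:
  assumes "finite {x\<in>E. F x \<noteq> 0}" "l \<in> Lines"
  shows "finite (supp_on G (\<lambda>k. F (\<iota> l k)))"
proof (rule finite_imageD)
  show "finite (\<iota> l ` supp_on G (\<lambda>k. F (\<iota> l k)))"
    by (rule finite_subset[OF _ assms(1)]) (auto simp: supp_on_def in_E assms(2))
  show "inj_on (\<iota> l) (supp_on G (\<lambda>k. F (\<iota> l k)))"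
    using inj_slice[OF assms(2)] by (rule inj_on_subset) (auto simp: supp_on_def)
qed

lemma card_slice:
  assumes "l \<in> Lines"
  shows "card {y\<in>E. P y \<and> p y = l} = card {k\<in>carrier G. P (\<iota> l k)}"
proof -
  have "{y\<in>E. P y \<and> p y = l} = \<iota> l ` {k\<in>carrier G. P (\<iota> l k)}"
    using assms by (auto simp: in_E p elim!: E_cases)
  then show ?thesis
    using inj_slice[OF assms] by (simp add: card_image inj_on_def)
qed

text \<open>A random walk on \<open>E\<close> that moves along lines by right multiplication has as energy the sum of the
  energies of the restrictions.\<close>

lemma nn_integral_dirichlet_form_slices:
  assumes \<phi>: "set_pmf \<phi> \<subseteq> carrier G"
    and m: "\<And>l k y. l \<in> Lines \<Longrightarrow> k \<in> carrier G \<Longrightarrow> y \<in> carrier G \<Longrightarrow> m (\<iota> l k) y = \<iota> l (k \<otimes> y)"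
  shows "(\<integral>\<^sup>+l. dirichlet_form G \<phi> (\<lambda>k. F (\<iota> l k)) \<partial>count_space Lines) =
    ennreal (1/2) * (\<integral>\<^sup>+x. \<integral>\<^sup>+y. ennreal ((F (m x y) - F x)\<^sup>2) \<partial>\<phi> \<partial>count_space E)"
proof -
  have "(\<integral>\<^sup>+y. ennreal ((F (m (\<iota> l k) y) - F (\<iota> l k))\<^sup>2) \<partial>\<phi>) = (\<integral>\<^sup>+y. ennreal ((F (\<iota> l (k \<otimes> y)) - F (\<iota> l k))\<^sup>2) \<partial>\<phi>)"
    if "l \<in> Lines" "k \<in> carrier G" for l k
    using that \<phi> by (intro nn_integral_cong_AE AE_pmfI) (auto simp: m)
  then have "(\<integral>\<^sup>+x. \<integral>\<^sup>+y. ennreal ((F (m x y) - F x)\<^sup>2) \<partial>\<phi> \<partial>count_space E) =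
     (\<integral>\<^sup>+l. \<integral>\<^sup>+k. \<integral>\<^sup>+y. ennreal ((F (\<iota> l (k \<otimes> y)) - F (\<iota> l k))\<^sup>2) \<partial>\<phi> \<partial>count_space (carrier G) \<partial>count_space Lines)"
    unfolding nn_integral_slices by (simp cong: nn_integral_cong_simp)
  then show ?thesis
    unfolding dirichlet_form_nn_integral[OF \<phi>] by (simp add: nn_integral_cmult)
qed

text \<open>Here \<open>\<tau> x\<close> is the threshold of \<open>level_threshold\<close> for the line through \<open>x\<close>: above it the line is poor.\<close>

lemma level_thresholds:
  fixes F :: "'x \<Rightarrow> real"
  assumes \<phi>: "set_pmf \<phi> \<subseteq> carrier G" and fin: "finite {x\<in>E. F x \<noteq> 0}" and s: "0 < s" and b: "1 \<le> b"
    and gap: "\<And>u. finite (supp_on G u) \<Longrightarrow> card (supp_on G u) < b \<Longrightarrow>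
      ennreal (s * sq_norm G u) \<le> dirichlet_form G \<phi> u"
  obtains \<tau> where "\<And>x. x \<in> E \<Longrightarrow> 0 \<le> \<tau> x"
    "\<And>x t. x \<in> E \<Longrightarrow> 0 \<le> t \<Longrightarrow> card {y\<in>E. t < (F y)\<^sup>2 \<and> p y = p x} < b \<Longrightarrow> \<tau> x \<le> t"
    "ennreal (\<Sum>x | x \<in> E \<and> F x \<noteq> 0. max 0 ((F x)\<^sup>2 - \<tau> x)) \<le>
       ennreal (17 / s) * (\<integral>\<^sup>+l. dirichlet_form G \<phi> (\<lambda>k. F (\<iota> l k)) \<partial>count_space Lines) +
       ennreal ((\<Sum>x | x \<in> E \<and> F x \<noteq> 0. (F x)\<^sup>2) / 16)"
proof -
  define f where "f l = (\<lambda>k. F (\<iota> l k))" for l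
  have finf: "finite (supp_on G (f l))" if "l \<in> Lines" for l
    unfolding f_def using fin that by (rule finite_supp_slice)
  define ok where "ok l t0 \<longleftrightarrow> 0 \<le> t0 \<and> (\<forall>t\<ge>0. card {k\<in>carrier G. t < (f l k)\<^sup>2} < b \<longrightarrow> t0 \<le> t) \<and>
      ennreal (\<Sum>k\<in>supp_on G (f l). max 0 ((f l k)\<^sup>2 - t0)) \<le>
       ennreal (17 / s) * dirichlet_form G \<phi> (f l) + ennreal (sq_norm G (f l) / 16)" for l t0
  have "\<exists>t0. ok l t0" if "l \<in> Lines" for l
    unfolding ok_def by (rule level_threshold[OF is_group \<phi> finf[OF that] s b gap]) blast+
  then have "\<exists>t0. \<forall>l\<in>Lines. ok l (t0 l)" by (intro bchoice) blast
  then obtain t0 where "\<And>l. l \<in> Lines \<Longrightarrow> ok l (t0 l)" by blast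
  then have t0: "\<And>l. l \<in> Lines \<Longrightarrow> 0 \<le> t0 l"
    "\<And>l t. l \<in> Lines \<Longrightarrow> 0 \<le> t \<Longrightarrow> card {k\<in>carrier G. t < (f l k)\<^sup>2} < b \<Longrightarrow> t0 l \<le> t"
    "\<And>l. l \<in> Lines \<Longrightarrow> ennreal (\<Sum>k\<in>supp_on G (f l). max 0 ((f l k)\<^sup>2 - t0 l)) \<le>
       ennreal (17 / s) * dirichlet_form G \<phi> (f l) + ennreal (sq_norm G (f l) / 16)"
    unfolding ok_def by blast+
  have sum_eq: "ennreal (\<Sum>x | x \<in> E \<and> F x \<noteq> 0. h x) = (\<integral>\<^sup>+x. ennreal (h x) \<partial>count_space E)"
    if "\<And>x. x \<in> E \<Longrightarrow> F x = 0 \<Longrightarrow> h x = 0" "\<And>x. x \<in> E \<Longrightarrow> 0 \<le> h x" for h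
    using fin that by (subst nn_integral_count_space'[of "{x\<in>E. F x \<noteq> 0}"]) (auto intro!: sum_ennreal[symmetric])
  have slice_eq: "ennreal (\<Sum>k\<in>supp_on G (f l). h k) = (\<integral>\<^sup>+k. ennreal (h k) \<partial>count_space (carrier G))"
    if "l \<in> Lines" "\<And>k. k \<in> carrier G \<Longrightarrow> f l k = 0 \<Longrightarrow> h k = 0" "\<And>k. k \<in> carrier G \<Longrightarrow> 0 \<le> h k" for l h
    using finf[OF that(1)] that(2,3)
    by (subst nn_integral_count_space'[of "supp_on G (f l)"]) (auto simp: supp_on_def intro!: sum_ennreal[symmetric])
  have "ennreal (\<Sum>x | x \<in> E \<and> F x \<noteq> 0. max 0 ((F x)\<^sup>2 - t0 (p x))) =
      (\<integral>\<^sup>+x. ennreal (max 0 ((F x)\<^sup>2 - t0 (p x))) \<partial>count_space E)"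
    using t0(1)[OF p_in] by (intro sum_eq) (auto simp: max_def intro: antisym)
  also have "\<dots> = (\<integral>\<^sup>+l. \<integral>\<^sup>+k. ennreal (max 0 ((f l k)\<^sup>2 - t0 l)) \<partial>count_space (carrier G) \<partial>count_space Lines)"
    unfolding nn_integral_slices by (intro nn_integral_cong) (simp add: p f_def)
  also have "\<dots> = (\<integral>\<^sup>+l. ennreal (\<Sum>k\<in>supp_on G (f l). max 0 ((f l k)\<^sup>2 - t0 l)) \<partial>count_space Lines)"
    by (intro nn_integral_cong slice_eq[symmetric]) (auto simp: max_def t0(1) intro: antisym)
  also have "\<dots> \<le> (\<integral>\<^sup>+l. ennreal (17 / s) * dirichlet_form G \<phi> (f l) + ennreal (sq_norm G (f l) / 16) \<partial>count_space Lines)"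
    by (intro nn_integral_mono t0(3)) simp
  also have "\<dots> = ennreal (17 / s) * (\<integral>\<^sup>+l. dirichlet_form G \<phi> (f l) \<partial>count_space Lines) +
      (\<integral>\<^sup>+l. ennreal (sq_norm G (f l) / 16) \<partial>count_space Lines)"
    by (simp add: nn_integral_add nn_integral_cmult)
  also have "(\<integral>\<^sup>+l. ennreal (sq_norm G (f l) / 16) \<partial>count_space Lines) =
      (\<integral>\<^sup>+l. \<integral>\<^sup>+k. ennreal ((f l k)\<^sup>2 / 16) \<partial>count_space (carrier G) \<partial>count_space Lines)"
    unfolding sq_norm_def sum_divide_distrib by (intro nn_integral_cong slice_eq) auto
  also have "\<dots> = (\<integral>\<^sup>+x. ennreal ((F x)\<^sup>2 / 16) \<partial>count_space E)"
    unfolding nn_integral_slices f_def ..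
  also have "\<dots> = ennreal ((\<Sum>x | x \<in> E \<and> F x \<noteq> 0. (F x)\<^sup>2) / 16)"
    unfolding sum_divide_distrib by (rule sum_eq[symmetric]) auto
  finally have *: "ennreal (\<Sum>x | x \<in> E \<and> F x \<noteq> 0. max 0 ((F x)\<^sup>2 - t0 (p x))) \<le>
       ennreal (17 / s) * (\<integral>\<^sup>+l. dirichlet_form G \<phi> (\<lambda>k. F (\<iota> l k)) \<partial>count_space Lines) +
       ennreal ((\<Sum>x | x \<in> E \<and> F x \<noteq> 0. (F x)\<^sup>2) / 16)"
    unfolding f_def .
  show ?thesis
  proof (rule that[OF _ _ *])
    fix x assume "x \<in> E"
    then show "0 \<le> t0 (p x)" using t0(1)[OF p_in] by simp
  next
    fix x t assume "x \<in> E" "(0::real) \<le> t" "card {y\<in>E. t < (F y)\<^sup>2 \<and> p y = p x} < b"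
    then show "t0 (p x) \<le> t"
      using t0(2)[OF p_in, of x t] card_slice[OF p_in, of x "\<lambda>y. t < (F y)\<^sup>2"] by (simp add: f_def)
  qed
qed

text \<open>If \<open>F\<close> is a multiple of one function \<open>g\<close> on every line, then all restrictions have the Rayleigh quotient
  of \<open>g\<close>, and hence so has \<open>F\<close>.  Stated as a product, this also covers lines on which \<open>F\<close> vanishes.\<close>

lemma nn_integral_dirichlet_form_proportional:
  assumes \<phi>: "set_pmf \<phi> \<subseteq> carrier G" and fin: "finite (supp_on G g)"
    and multiple: "\<And>l. l \<in> Lines \<Longrightarrow> \<exists>c. \<forall>k\<in>carrier G. F (\<iota> l k) = c * g k"
  shows "(\<integral>\<^sup>+l. dirichlet_form G \<phi> (\<lambda>k. F (\<iota> l k)) \<partial>count_space Lines) * ennreal (sq_norm G g) =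
    dirichlet_form G \<phi> g * (\<integral>\<^sup>+x. ennreal ((F x)\<^sup>2) \<partial>count_space E)"
proof -
  have "dirichlet_form G \<phi> (\<lambda>k. F (\<iota> l k)) * ennreal (sq_norm G g) =
      dirichlet_form G \<phi> g * (\<integral>\<^sup>+k. ennreal ((F (\<iota> l k))\<^sup>2) \<partial>count_space (carrier G))"
    if l: "l \<in> Lines" for l
  proof -
    obtain c where c: "\<And>k. k \<in> carrier G \<Longrightarrow> F (\<iota> l k) = c * g k" using multiple[OF l] by blast
    have "dirichlet_form G \<phi> (\<lambda>k. F (\<iota> l k)) = ennreal (c\<^sup>2) * dirichlet_form G \<phi> g"
      using dirichlet_form_cong[OF \<phi> is_group c] dirichlet_form_scale[OF \<phi>] by simp
    moreover have "(\<integral>\<^sup>+k. ennreal ((F (\<iota> l k))\<^sup>2) \<partial>count_space (carrier G)) =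
        (\<integral>\<^sup>+k. ennreal (c\<^sup>2) * ennreal ((g k)\<^sup>2) \<partial>count_space (carrier G))"
      by (intro nn_integral_cong) (simp add: c power_mult_distrib ennreal_mult)
    ultimately show ?thesis
      by (simp add: nn_integral_cmult ennreal_sq_norm_nn_integral[OF fin] ac_simps)
  qed
  then have "(\<integral>\<^sup>+l. dirichlet_form G \<phi> (\<lambda>k. F (\<iota> l k)) * ennreal (sq_norm G g) \<partial>count_space Lines) =
     (\<integral>\<^sup>+l. dirichlet_form G \<phi> g * (\<integral>\<^sup>+k. ennreal ((F (\<iota> l k))\<^sup>2) \<partial>count_space (carrier G)) \<partial>count_space Lines)"
    by (intro nn_integral_cong) simp
  then show ?thesis
    by (simp add: nn_integral_multc nn_integral_cmult nn_integral_slices)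
qed

end


section \<open>Lamp lines and base lines of a wreath product\<close>

lemma carrier_wreath_product:
  "carrier (wreath_product H1 H2) = carrier (lamp_group H1 H2) \<times> carrier H2"
  by (simp add: wreath_product_def)

lemma carrier_lamp_group:
  assumes "group H1"
  shows "f \<in> carrier (lamp_group H1 H2) \<longleftrightarrow>
    f \<in> carrier H2 \<rightarrow>\<^sub>E carrier H1 \<and> finite {x \<in> carrier H2. f x \<noteq> \<one>\<^bsub>H1\<^esub>}"
  using assms by (auto simp: carrier_sum_group)

lemma lamp_group_update:
  assumes "group H1" "f \<in> carrier (lamp_group H1 H2)" "h \<in> carrier H2" "k \<in> carrier H1"
  shows "f(h := k) \<in> carrier (lamp_group H1 H2)"
proof -
  have "finite (insert h {x \<in> carrier H2. f x \<noteq> \<one>\<^bsub>H1\<^esub>})"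
    using assms(2) by (simp add: carrier_lamp_group[OF assms(1)])
  then have "finite {x \<in> carrier H2. (f(h := k)) x \<noteq> \<one>\<^bsub>H1\<^esub>}"
    by (rule rev_finite_subset) auto
  then show ?thesis
    using assms by (auto simp: carrier_lamp_group[OF assms(1)] PiE_iff extensional_def)
qed

text \<open>A lamp line is represented by its element whose lamp at the marked point is switched off.\<close>

definition lamp_lines where
  "lamp_lines H1 H2 = {(f, h). f \<in> carrier (lamp_group H1 H2) \<and> h \<in> carrier H2 \<and> f h = \<one>\<^bsub>H1\<^esub>}"

definition lamp_inclusion :: "('b \<Rightarrow> 'a) \<times> 'b \<Rightarrow> 'a \<Rightarrow> ('b \<Rightarrow> 'a) \<times> 'b" where
  "lamp_inclusion = (\<lambda>(f, h) k. (f(h := k), h))"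

definition lamp_projection :: "('a, 'c) monoid_scheme \<Rightarrow> ('b \<Rightarrow> 'a) \<times> 'b \<Rightarrow> ('b \<Rightarrow> 'a) \<times> 'b" where
  "lamp_projection H1 = (\<lambda>(f, h). (f(h := \<one>\<^bsub>H1\<^esub>), h))"

lemma base_fibration:
  assumes "group H1" "group H2"
  shows "fibration H2 (carrier (wreath_product H1 H2)) (carrier (lamp_group H1 H2)) Pair fst"
  using assms
  by (auto simp: fibration_def fibration_axioms_def carrier_wreath_product bij_betw_def inj_on_def)

lemma lamp_fibration:
  assumes "group H1" "group H2"
  shows "fibration H1 (carrier (wreath_product H1 H2)) (lamp_lines H1 H2) lamp_inclusion (lamp_projection H1)"
proof -
  interpret H1: group H1 by fact
  note upd = lamp_group_update[OF assms(1)]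
  have p: "lamp_projection H1 (lamp_inclusion l k) = l" if "l \<in> lamp_lines H1 H2" for l k
    using that by (auto simp: lamp_projection_def lamp_inclusion_def lamp_lines_def fun_upd_idem)
  have in_E: "lamp_inclusion l k \<in> carrier (wreath_product H1 H2)"
    if "l \<in> lamp_lines H1 H2" "k \<in> carrier H1" for l k
    using that upd by (auto simp: lamp_inclusion_def lamp_lines_def carrier_wreath_product simp del: carrier_sum_group)
  have onto: "\<exists>l\<in>lamp_lines H1 H2. \<exists>k\<in>carrier H1. x = lamp_inclusion l k"
    if "x \<in> carrier (wreath_product H1 H2)" for x
  proof -
    obtain f h where x: "x = (f, h)" "f \<in> carrier (lamp_group H1 H2)" "h \<in> carrier H2"
      using \<open>x \<in> _\<close> by (auto simp: carrier_wreath_product simp del: carrier_sum_group)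
    then have "f h \<in> carrier H1" by (auto simp: carrier_lamp_group[OF assms(1)])
    moreover have "(f(h := \<one>\<^bsub>H1\<^esub>), h) \<in> lamp_lines H1 H2"
      using upd[OF x(2,3) H1.one_closed] x(3) by (simp add: lamp_lines_def del: carrier_sum_group)
    moreover have "x = lamp_inclusion (f(h := \<one>\<^bsub>H1\<^esub>), h) (f h)"
      by (simp add: x lamp_inclusion_def)
    ultimately show ?thesis by blast
  qed
  have "inj_on (\<lambda>(l, k). lamp_inclusion l k) (lamp_lines H1 H2 \<times> carrier H1)"
  proof (rule inj_onI)
    fix x y assume xy: "x \<in> lamp_lines H1 H2 \<times> carrier H1" "y \<in> lamp_lines H1 H2 \<times> carrier H1"
      "(case x of (l, k) \<Rightarrow> lamp_inclusion l k) = (case y of (l, k) \<Rightarrow> lamp_inclusion l k)"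
    obtain l k where x: "x = (l, k)" "l \<in> lamp_lines H1 H2" using xy(1) by blast
    obtain l' k' where y: "y = (l', k')" "l' \<in> lamp_lines H1 H2" using xy(2) by blast
    have eq: "lamp_inclusion l k = lamp_inclusion l' k'" using xy(3) x(1) y(1) by simp
    have "l = l'" using p[OF x(2), of k] p[OF y(2), of k'] eq by simp
    moreover have "k = k'"
      using arg_cong[OF eq, of "\<lambda>z. fst z (snd l)"] \<open>l = l'\<close> by (simp add: lamp_inclusion_def case_prod_beta)
    ultimately show "x = y" by (simp add: x y)
  qed
  moreover have "(\<lambda>(l, k). lamp_inclusion l k) ` (lamp_lines H1 H2 \<times> carrier H1) = carrier (wreath_product H1 H2)"
  proof (intro equalityI subsetI)
    fix x assume "x \<in> carrier (wreath_product H1 H2)"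
    then show "x \<in> (\<lambda>(l, k). lamp_inclusion l k) ` (lamp_lines H1 H2 \<times> carrier H1)"
      using onto by (auto simp: image_iff)
  qed (auto simp: in_E)
  ultimately show ?thesis
    using p by (simp add: fibration_def fibration_axioms_def bij_betw_def assms)
qed

lemma wreath_mult_lamp_embed:
  assumes "group H1" "group H2" "f \<in> carrier (lamp_group H1 H2)" "h \<in> carrier H2" "k \<in> carrier H1"
  shows "(f, h) \<otimes>\<^bsub>wreath_product H1 H2\<^esub> lamp_embed H1 H2 k = (f(h := f h \<otimes>\<^bsub>H1\<^esub> k), h)"
proof -
  interpret H1: group H1 by fact
  interpret H2: group H2 by fact
  have f: "f \<in> carrier H2 \<rightarrow>\<^sub>E carrier H1"
    using assms by (simp add: carrier_lamp_group)
  have "inv\<^bsub>H2\<^esub> h \<otimes>\<^bsub>H2\<^esub> x = \<one>\<^bsub>H2\<^esub> \<longleftrightarrow> x = h" if "x \<in> carrier H2" for x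
    using that assms(4) by (metis H2.inv_closed H2.inv_inv H2.inv_solve_left H2.one_closed H2.r_one)
  then show ?thesis
    using f assms(4)
    by (auto simp: wreath_product_def lamp_embed_def translate_def PiE_iff extensional_def fun_eq_iff)
qed

lemma wreath_mult_base_embed:
  assumes "group H1" "group H2" "f \<in> carrier (lamp_group H1 H2)" "h \<in> carrier H2"
  shows "(f, h) \<otimes>\<^bsub>wreath_product H1 H2\<^esub> base_embed H1 H2 y = (f, h \<otimes>\<^bsub>H2\<^esub> y)"
proof -
  interpret H1: group H1 by fact
  interpret H2: group H2 by fact
  have f: "f \<in> carrier H2 \<rightarrow>\<^sub>E carrier H1"
    using assms by (simp add: carrier_lamp_group)
  then show ?thesis
    using assms(4)
    by (auto simp: wreath_product_def base_embed_def translate_def PiE_iff extensional_def fun_eq_iff)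
qed

lemma set_pmf_switch_or_walk:
  assumes "group H1" "group H2" "set_pmf \<mu>1 \<subseteq> carrier H1" "set_pmf \<mu>2 \<subseteq> carrier H2"
  shows "set_pmf (switch_or_walk H1 H2 \<mu>1 \<mu>2) \<subseteq> carrier (wreath_product H1 H2)"
proof -
  interpret H1: group H1 by fact
  interpret H2: group H2 by fact
  let ?W = "wreath_product H1 H2"
  have const: "(\<lambda>x\<in>carrier H2. \<one>\<^bsub>H1\<^esub>) \<in> carrier (lamp_group H1 H2)"
    by (auto simp: carrier_lamp_group[OF assms(1)] cong: conj_cong)
  have le: "lamp_embed H1 H2 k \<in> carrier ?W" if "k \<in> carrier H1" for k
  proof -
    have "lamp_embed H1 H2 k = ((\<lambda>x\<in>carrier H2. \<one>\<^bsub>H1\<^esub>)(\<one>\<^bsub>H2\<^esub> := k), \<one>\<^bsub>H2\<^esub>)"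
      by (auto simp: lamp_embed_def)
    then show ?thesis
      using lamp_group_update[OF assms(1) const _ that, of "\<one>\<^bsub>H2\<^esub>"]
      by (simp add: carrier_wreath_product del: carrier_sum_group)
  qed
  have be: "base_embed H1 H2 y \<in> carrier ?W" if "y \<in> carrier H2" for y
    using const that by (simp add: base_embed_def carrier_wreath_product del: carrier_sum_group)
  have "set_pmf (map_pmf (lamp_embed H1 H2) \<mu>1) \<subseteq> carrier ?W" "set_pmf (map_pmf (base_embed H1 H2) \<mu>2) \<subseteq> carrier ?W"
    using assms(3,4) le be unfolding set_map_pmf by blast+
  then show ?thesis
    unfolding switch_or_walk_def set_bind_pmf by (intro UN_least) (simp del: set_map_pmf)
qed

text \<open>The factors \<open>1/2\<close> are the probabilities of switching and of walking.  Switching multiplies the lamp at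
  the current position from the right, and walking moves the position with the lamps fixed.\<close>

lemma dirichlet_form_switch_or_walk:
  assumes "group H1" "group H2" "set_pmf \<mu>1 \<subseteq> carrier H1" "set_pmf \<mu>2 \<subseteq> carrier H2"
  shows "dirichlet_form (wreath_product H1 H2) (switch_or_walk H1 H2 \<mu>1 \<mu>2) F =
    ennreal (1/2) * (\<integral>\<^sup>+l. dirichlet_form H1 \<mu>1 (\<lambda>k. F (lamp_inclusion l k)) \<partial>count_space (lamp_lines H1 H2)) +
    ennreal (1/2) * (\<integral>\<^sup>+f. dirichlet_form H2 \<mu>2 (\<lambda>h. F (f, h)) \<partial>count_space (carrier (lamp_group H1 H2)))"
proof -
  interpret H1: group H1 by fact
  interpret H2: group H2 by fact
  interpret base: fibration H2 "carrier (wreath_product H1 H2)" "carrier (lamp_group H1 H2)" Pair fst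
    using assms by (intro base_fibration)
  interpret lamp: fibration H1 "carrier (wreath_product H1 H2)" "lamp_lines H1 H2" lamp_inclusion "lamp_projection H1"
    using assms by (intro lamp_fibration)
  let ?W = "wreath_product H1 H2"
  note sub = set_pmf_switch_or_walk[OF assms]
  let ?I1 = "\<lambda>x. \<integral>\<^sup>+k. ennreal ((F (x \<otimes>\<^bsub>?W\<^esub> lamp_embed H1 H2 k) - F x)\<^sup>2) \<partial>\<mu>1"
  let ?I2 = "\<lambda>x. \<integral>\<^sup>+y. ennreal ((F (x \<otimes>\<^bsub>?W\<^esub> base_embed H1 H2 y) - F x)\<^sup>2) \<partial>\<mu>2"
  have "(\<integral>\<^sup>+y. ennreal ((F (x \<otimes>\<^bsub>?W\<^esub> y) - F x)\<^sup>2) \<partial>switch_or_walk H1 H2 \<mu>1 \<mu>2) =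
      ennreal (1/2) * ?I1 x + ennreal (1/2) * ?I2 x" for x
    unfolding switch_or_walk_def by (simp add: mult.commute)
  then have "dirichlet_form ?W (switch_or_walk H1 H2 \<mu>1 \<mu>2) F =
     ennreal (1/2) * (ennreal (1/2) * (\<integral>\<^sup>+x. ?I1 x \<partial>count_space (carrier ?W))) +
     ennreal (1/2) * (ennreal (1/2) * (\<integral>\<^sup>+x. ?I2 x \<partial>count_space (carrier ?W)))"
    unfolding dirichlet_form_nn_integral[OF sub]
    by (simp add: nn_integral_add nn_integral_cmult distrib_left)
  also have "ennreal (1/2) * (\<integral>\<^sup>+x. ?I1 x \<partial>count_space (carrier ?W)) =
      (\<integral>\<^sup>+l. dirichlet_form H1 \<mu>1 (\<lambda>k. F (lamp_inclusion l k)) \<partial>count_space (lamp_lines H1 H2))"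
  proof (rule lamp.nn_integral_dirichlet_form_slices[OF assms(3), symmetric])
    fix l k y assume "l \<in> lamp_lines H1 H2" and k: "k \<in> carrier H1" "y \<in> carrier H1"
    then obtain f h where l: "l = (f, h)" "f \<in> carrier (lamp_group H1 H2)" "h \<in> carrier H2"
      by (auto simp: lamp_lines_def)
    show "lamp_inclusion l k \<otimes>\<^bsub>?W\<^esub> lamp_embed H1 H2 y = lamp_inclusion l (k \<otimes>\<^bsub>H1\<^esub> y)"
      using wreath_mult_lamp_embed[OF assms(1,2) lamp_group_update[OF assms(1) l(2,3) k(1)] l(3) k(2)]
      by (simp add: l lamp_inclusion_def)
  qed
  also have "ennreal (1/2) * (\<integral>\<^sup>+x. ?I2 x \<partial>count_space (carrier ?W)) =
      (\<integral>\<^sup>+f. dirichlet_form H2 \<mu>2 (\<lambda>h. F (f, h)) \<partial>count_space (carrier (lamp_group H1 H2)))"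
    using wreath_mult_base_embed[OF assms(1,2)]
    by (intro base.nn_integral_dirichlet_form_slices[OF assms(4), symmetric]) blast
  finally show ?thesis .
qed

section \<open>Lower bound for the profile of a wreath product\<close>

text \<open>The constant is \<open>272 = 16 \<cdot> 17\<close>: the two families of lines together lose at most
  \<open>(17 / s) \<cdot> 2 \<cdot> energy + 2 / 16\<close> of the unit mass, and this must be below \<open>1/4\<close> for \<open>exists_level\<close> to apply.\<close>

lemma wreath_support_lower_bound:
  fixes H1 :: "('a, 'c) monoid_scheme" and H2 :: "('b, 'd) monoid_scheme" and A B :: nat
  assumes H: "group H1" "group H2" and \<mu>: "set_pmf \<mu>1 \<subseteq> carrier H1" "set_pmf \<mu>2 \<subseteq> carrier H2"
    and s: "0 < s" and A: "1 \<le> A" and B: "1 \<le> B"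
    and gap1: "\<And>u. finite (supp_on H1 u) \<Longrightarrow> card (supp_on H1 u) < A \<Longrightarrow>
      ennreal (s * sq_norm H1 u) \<le> dirichlet_form H1 \<mu>1 u"
    and gap2: "\<And>u. finite (supp_on H2 u) \<Longrightarrow> card (supp_on H2 u) < B \<Longrightarrow>
      ennreal (s * sq_norm H2 u) \<le> dirichlet_form H2 \<mu>2 u"
    and fin: "finite (supp_on (wreath_product H1 H2) F)" and norm: "sq_norm (wreath_product H1 H2) F = 1"
    and small: "dirichlet_form (wreath_product H1 H2) (switch_or_walk H1 H2 \<mu>1 \<mu>2) F < ennreal (s / 272)"
  shows "B \<le> card (supp_on (wreath_product H1 H2) F)"
    "real A powr (real B / 8) \<le> card (supp_on (wreath_product H1 H2) F)"
proof -
  define E where "E = carrier (wreath_product H1 H2)"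
  define q :: "('b \<Rightarrow> 'a) \<times> 'b \<Rightarrow> ('b \<Rightarrow> 'a) \<times> 'b" where "q = lamp_projection H1"
  interpret base: fibration H2 E "carrier (lamp_group H1 H2)" Pair fst
    unfolding E_def using H by (rule base_fibration)
  interpret lamp: fibration H1 E "lamp_lines H1 H2" lamp_inclusion q
    unfolding E_def q_def using H by (rule lamp_fibration)
  define \<Omega> where "\<Omega> = {x\<in>E. F x \<noteq> 0}"
  have supp: "supp_on (wreath_product H1 H2) F = \<Omega>" by (simp add: supp_on_def \<Omega>_def E_def)
  have fin\<Omega>: "finite {x\<in>E. F x \<noteq> 0}" using fin supp by (simp add: \<Omega>_def)
  have one: "(\<Sum>x\<in>\<Omega>. (F x)\<^sup>2) = 1" using norm by (simp add: sq_norm_def supp)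
  define E1 where "E1 = (\<integral>\<^sup>+l. dirichlet_form H1 \<mu>1 (\<lambda>k. F (lamp_inclusion l k)) \<partial>count_space (lamp_lines H1 H2))"
  define E2 where "E2 = (\<integral>\<^sup>+f. dirichlet_form H2 \<mu>2 (\<lambda>h. F (f, h)) \<partial>count_space (carrier (lamp_group H1 H2)))"
  obtain \<tau>1 where \<tau>1: "\<And>x t. x \<in> E \<Longrightarrow> 0 \<le> t \<Longrightarrow> card {y\<in>E. t < (F y)\<^sup>2 \<and> q y = q x} < A \<Longrightarrow> \<tau>1 x \<le> t"
    "ennreal (\<Sum>x\<in>\<Omega>. max 0 ((F x)\<^sup>2 - \<tau>1 x)) \<le> ennreal (17 / s) * E1 + ennreal (1 / 16)"
    by (rule lamp.level_thresholds[OF \<mu>(1) fin\<Omega> s A gap1, folded \<Omega>_def E1_def, unfolded one]) blast+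
  obtain \<tau>2 where \<tau>2: "\<And>x t. x \<in> E \<Longrightarrow> 0 \<le> t \<Longrightarrow> card {y\<in>E. t < (F y)\<^sup>2 \<and> fst y = fst x} < B \<Longrightarrow> \<tau>2 x \<le> t"
    "ennreal (\<Sum>x\<in>\<Omega>. max 0 ((F x)\<^sup>2 - \<tau>2 x)) \<le> ennreal (17 / s) * E2 + ennreal (1 / 16)"
    by (rule base.level_thresholds[OF \<mu>(2) fin\<Omega> s B gap2, folded \<Omega>_def E2_def, unfolded one]) blast+
  have sum_small: "(\<Sum>x\<in>\<Omega>. max 0 ((F x)\<^sup>2 - \<tau>1 x)) + (\<Sum>x\<in>\<Omega>. max 0 ((F x)\<^sup>2 - \<tau>2 x)) < (\<Sum>x\<in>\<Omega>. (F x)\<^sup>2) / 4"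
  proof -
    have lt: "ennreal (1/2) * (E1 + E2) < ennreal (s / 272)"
      using small dirichlet_form_switch_or_walk[OF H \<mu>, of F] by (simp add: E1_def E2_def distrib_left)
    then have "E1 + E2 \<noteq> \<infinity>" by (auto simp: ennreal_mult_top)
    then obtain r where r: "0 \<le> r" "E1 + E2 = ennreal r" by (cases "E1 + E2") auto
    have "ennreal (1/2 * r) = ennreal (1/2) * ennreal r" using r(1) by (intro ennreal_mult) auto
    then have "ennreal (1/2 * r) < ennreal (s / 272)" using lt by (simp only: r(2))
    then have "1/2 * r < s / 272" by (rule ennreal_less_iff[THEN iffD1, rotated]) (use r in simp)
    then have r_lt: "r < s / 136" by simp
    let ?S1 = "\<Sum>x\<in>\<Omega>. max 0 ((F x)\<^sup>2 - \<tau>1 x)" and ?S2 = "\<Sum>x\<in>\<Omega>. max 0 ((F x)\<^sup>2 - \<tau>2 x)"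
    have nn: "0 \<le> ?S1" "0 \<le> ?S2" by (auto intro: sum_nonneg)
    have "ennreal (?S1 + ?S2) = ennreal ?S1 + ennreal ?S2" using nn by simp
    also have "\<dots> \<le> (ennreal (17 / s) * E1 + ennreal (1 / 16)) + (ennreal (17 / s) * E2 + ennreal (1 / 16))"
      by (intro add_mono \<tau>1 \<tau>2)
    also have "\<dots> = ennreal (17 / s) * (E1 + E2) + (ennreal (1 / 16) + ennreal (1 / 16))"
      unfolding distrib_left by (simp only: ac_simps)
    also have "\<dots> = ennreal (17 / s * r + (1 / 16 + 1 / 16))"
      using r s by (simp add: ennreal_mult[symmetric] ennreal_plus[symmetric] del: ennreal_plus)
    finally have "?S1 + ?S2 \<le> 17 / s * r + (1 / 16 + 1 / 16)"
      using r s by (subst (asm) ennreal_le_iff) auto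
    also have "\<dots> < 1 / 4" using r_lt s by (simp add: field_simps)
    finally show ?thesis using one by simp
  qed
  \<comment> \<open>From here on only the superlevel set \<open>\<Omega>t\<close> at this level matters, with counting measure.\<close>
  obtain t where t: "0 < t"
    "4 * (card {x\<in>\<Omega>. \<tau>1 x \<le> t \<and> t < (F x)\<^sup>2} + card {x\<in>\<Omega>. \<tau>2 x \<le> t \<and> t < (F x)\<^sup>2}) < card {x\<in>\<Omega>. t < (F x)\<^sup>2}"
    using exists_level[OF _ _ sum_small] fin supp by auto
  define \<Omega>t where "\<Omega>t = {x\<in>\<Omega>. t < (F x)\<^sup>2}"
  have \<Omega>t: "\<Omega>t \<subseteq> \<Omega>" "finite \<Omega>t" using fin supp by (auto simp: \<Omega>t_def)
  have line: "{y\<in>\<Omega>t. P y} = {y\<in>E. t < (F y)\<^sup>2 \<and> P y}" for P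
    using t(1) by (auto simp: \<Omega>t_def \<Omega>_def)
  have "card {x\<in>\<Omega>t. card {y\<in>\<Omega>t. q y = q x} < A} \<le> card {x\<in>\<Omega>. \<tau>1 x \<le> t \<and> t < (F x)\<^sup>2}"
    "card {x\<in>\<Omega>t. card {y\<in>\<Omega>t. fst y = fst x} < B} \<le> card {x\<in>\<Omega>. \<tau>2 x \<le> t \<and> t < (F x)\<^sup>2}"
    using \<tau>1(1) \<tau>2(1) t(1) unfolding line
    by (auto intro!: card_mono finite_subset[OF _ fin\<Omega>] simp: \<Omega>t_def \<Omega>_def)
  then have few: "4 * (card {x\<in>\<Omega>t. card {y\<in>\<Omega>t. q y = q x} < A} + card {x\<in>\<Omega>t. card {y\<in>\<Omega>t. fst y = fst x} < B}) < card \<Omega>t"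
    using t(2) unfolding \<Omega>t_def[symmetric] by presburger
  show "B \<le> card (supp_on (wreath_product H1 H2) F)"
  proof (rule ccontr)
    assume "\<not> B \<le> card (supp_on (wreath_product H1 H2) F)"
    then have "card {y\<in>\<Omega>t. fst y = fst x} < B" for x
      using card_mono[of \<Omega> "{y\<in>\<Omega>t. fst y = fst x}"] \<Omega>t fin supp by fastforce
    then have "{x\<in>\<Omega>t. card {y\<in>\<Omega>t. fst y = fst x} < B} = \<Omega>t" by blast
    then show False using few by simp
  qed
  obtain S where S: "S \<subseteq> \<Omega>t" "S \<noteq> {}" "\<And>x. x \<in> S \<Longrightarrow> A < 2 * card {y\<in>S. q y = q x}"
    "\<And>x. x \<in> S \<Longrightarrow> B < 4 * card {y\<in>S. fst y = fst x}"
    by (rule thick_subset[OF \<Omega>t(2) few]) blast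
  have finS: "finite S" using S(1) \<Omega>t(2) finite_subset by blast
  \<comment> \<open>The coordinates in which a configuration \<open>f\<close> of \<open>S\<close> can be varied are the points of the base line of
    \<open>f\<close> in \<open>S\<close>, and the variations at \<open>h\<close> are the points of the lamp line through \<open>(f, h)\<close>.\<close>
  have "(A div 2 + 1) ^ (B div 4 + 1) \<le> card (fst ` S)"
  proof (rule card_ge_power_of_variations)
    fix f assume "f \<in> fst ` S"
    then obtain h0 where h0: "(f, h0) \<in> S" by force
    define D where "D = {h. (f, h) \<in> S}"
    have "{y\<in>S. fst y = f} = Pair f ` D" by (auto simp: D_def)
    then have cardD: "card {y\<in>S. fst y = f} = card D" by (simp add: card_image inj_on_def)
    have "D \<subseteq> snd ` S" by (force simp: D_def)
    then have "finite D" using finS finite_subset by blast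
    moreover have "B div 4 + 1 \<le> card D" using S(4)[OF h0] cardD by simp
    moreover have "A div 2 + 1 \<le> card {f'\<in>fst ` S. \<forall>x. x \<noteq> h \<longrightarrow> f' x = f x}" if "h \<in> D" for h
    proof -
      have fh: "(f, h) \<in> S" using that by (simp add: D_def)
      let ?L = "{y\<in>S. q y = q (f, h)}"
      have L: "snd y = h \<and> (\<forall>x. x \<noteq> h \<longrightarrow> fst y x = f x)" if "y \<in> ?L" for y
      proof -
        obtain f' h' where y: "y = (f', h')" by (cases y)
        have "h' = h" "f'(h' := \<one>\<^bsub>H1\<^esub>) = f(h := \<one>\<^bsub>H1\<^esub>)" using that by (auto simp: y q_def lamp_projection_def)
        then show ?thesis using y by (metis fst_conv snd_conv fun_upd_other)
      qed
      have "inj_on fst ?L" using L by (intro inj_onI prod_eqI) (auto simp del: split_paired_All)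
      then have "card ?L = card (fst ` ?L)" by (simp add: card_image)
      also have "\<dots> \<le> card {f'\<in>fst ` S. \<forall>x. x \<noteq> h \<longrightarrow> f' x = f x}"
        using L finS by (intro card_mono) auto
      finally show ?thesis using S(3)[OF fh] by simp
    qed
    ultimately show "\<exists>D. finite D \<and> B div 4 + 1 \<le> card D \<and>
        (\<forall>h\<in>D. A div 2 + 1 \<le> card {f'\<in>fst ` S. \<forall>x. x \<noteq> h \<longrightarrow> f' x = f x})"
      by blast
  qed (use finS S(2) in auto)
  also have "card (fst ` S) \<le> card S" using finS by (rule card_image_le)
  also have "\<dots> \<le> card \<Omega>" using S(1) \<Omega>t fin supp by (intro card_mono) auto
  finally have pow: "(A div 2 + 1) ^ (B div 4 + 1) \<le> card \<Omega>" .
  have "sqrt (real A) \<le> real (A div 2 + 1)"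
  proof -
    have "0 \<le> (sqrt (real A) - 1)\<^sup>2" by simp
    \<comment> \<open>More than \<open>A/2\<close> variations are at least \<open>\<surd>A\<close> of them, also for small \<open>A\<close>.\<close>
    then have "sqrt (real A) \<le> (real A + 1) / 2" by (simp add: power2_diff)
    also have "\<dots> \<le> real (A div 2 + 1)"
    proof -
      have "A + 1 \<le> 2 * (A div 2 + 1)" by presburger
      then have "real (A + 1) \<le> real (2 * (A div 2 + 1))" by (rule of_nat_mono)
      then show ?thesis by simp
    qed
    finally show ?thesis .
  qed
  then have "sqrt (real A) powr (real B / 4) \<le> real (A div 2 + 1) powr (real B / 4)"
    by (intro powr_mono2) auto
  also have "\<dots> \<le> real (A div 2 + 1) powr real (B div 4 + 1)"
  proof (rule powr_mono)
    have "B \<le> 4 * (B div 4 + 1)" by presburger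
    then have "real B \<le> real (4 * (B div 4 + 1))" by (rule of_nat_mono)
    then show "real B / 4 \<le> real (B div 4 + 1)" by simp
  qed simp
  also have "\<dots> = real ((A div 2 + 1) ^ (B div 4 + 1))"
    unfolding of_nat_power by (rule powr_realpow) simp
  also have "\<dots> \<le> real (card \<Omega>)" using pow by (rule of_nat_mono)
  also have "sqrt (real A) powr (real B / 4) = real A powr (real B / 8)"
    by (simp add: powr_half_sqrt[symmetric] powr_powr)
  finally show "real A powr (real B / 8) \<le> card (supp_on (wreath_product H1 H2) F)" by (simp add: supp)
qed


lemma epowr_of_nat:
  assumes "1 \<le> n" "1 \<le> m" "0 < K"
  shows "epowr (of_nat n) (of_nat m / ennreal K) = ennreal (real n powr (real m / K))"
proof -
  have "of_nat m / ennreal K = ennreal (real m / K)"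
    using assms by (simp add: ennreal_of_nat_eq_real_of_nat divide_ennreal)
  then show ?thesis
    using assms by (cases "n = 1") (simp_all add: epowr_def ennreal_of_nat_eq_real_of_nat ennreal_eq_1)
qed


text \<open>When an inverse profile is infinite, \<open>A\<close> or \<open>B\<close> may be taken arbitrarily large, which contradicts the
  finiteness of the support.  When both are finite, equality in the volume condition does no harm for
  \<open>a > 1\<close>, because \<open>a\<^bsup>b/272\<^esup> < a\<^bsup>b/8\<^esup>\<close>.  For \<open>a = 1\<close> the power gives only \<open>v \<le> 1\<close>, and the bound \<open>b \<le> v\<close> leaves
  just the excluded case.\<close>

lemma wreath_profile_lower_bound:
  fixes H1 :: "('a, 'c) monoid_scheme" and H2 :: "('b, 'd) monoid_scheme"
  assumes H: "group H1" "group H2" and \<mu>: "set_pmf \<mu>1 \<subseteq> carrier H1" "set_pmf \<mu>2 \<subseteq> carrier H2"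
    and s: "0 < s" and v: "0 < v"
    and le: "ennreal v \<le> epowr (l2_profile_inv H1 \<mu>1 s) (l2_profile_inv H2 \<mu>2 s / ennreal 272)"
    and nontrivial: "\<not> (v = 1 \<and> l2_profile_inv H1 \<mu>1 s = 1 \<and> l2_profile_inv H2 \<mu>2 s = 1)"
  shows "ennreal (s / 272) \<le> l2_profile (wreath_product H1 H2) (switch_or_walk H1 H2 \<mu>1 \<mu>2) v"
  unfolding l2_profile_def
proof (rule INF_greatest, rule ccontr)
  let ?W = "wreath_product H1 H2"
  fix F assume F: "F \<in> {f. finite (supp_on ?W f) \<and> real (card (supp_on ?W f)) \<le> v \<and> l2_norm_on ?W f = 1}"
    and "\<not> ennreal (s / 272) \<le> dirichlet_form ?W (switch_or_walk H1 H2 \<mu>1 \<mu>2) F"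
  then have small: "dirichlet_form ?W (switch_or_walk H1 H2 \<mu>1 \<mu>2) F < ennreal (s / 272)" by (simp add: not_le)
  have fin: "finite (supp_on ?W F)" and card: "real (card (supp_on ?W F)) \<le> v" using F by auto
  have norm: "sq_norm ?W F = 1" using F l2_norm_on_eq_sqrt_sq_norm[OF fin] by simp
  have bound: "real B \<le> v" "real A powr (real B / 8) \<le> v"
    if AB: "1 \<le> A" "1 \<le> B" and above: "\<And>w. w < real A \<Longrightarrow> ennreal s < l2_profile H1 \<mu>1 w"
      "\<And>w. w < real B \<Longrightarrow> ennreal s < l2_profile H2 \<mu>2 w" for A B :: nat
  proof -
    have gap1: "ennreal (s * sq_norm H1 u) \<le> dirichlet_form H1 \<mu>1 u"
      if "finite (supp_on H1 u)" "card (supp_on H1 u) < A" for u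
      using gap_of_profile[OF \<mu>(1) s above(1) that] .
    have gap2: "ennreal (s * sq_norm H2 u) \<le> dirichlet_form H2 \<mu>2 u"
      if "finite (supp_on H2 u)" "card (supp_on H2 u) < B" for u
      using gap_of_profile[OF \<mu>(2) s above(2) that] .
    show "real B \<le> v" "real A powr (real B / 8) \<le> v"
      using wreath_support_lower_bound[OF H \<mu> s AB gap1 gap2 fin norm small] card by simp_all
  qed
  have A_exists: "\<exists>A\<ge>1. \<forall>w<real A. ennreal s < l2_profile H1 \<mu>1 w"
    by (cases rule: l2_profile_inv_cases[of H1 \<mu>1 s]) auto
  show False
  proof (cases rule: l2_profile_inv_cases[of H2 \<mu>2 s])
    case infinite
    obtain A where "1 \<le> A" "\<And>w. w < real A \<Longrightarrow> ennreal s < l2_profile H1 \<mu>1 w" using A_exists by blast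
    from bound(1)[OF this(1) _ this(2) infinite(2), of "nat \<lceil>v\<rceil> + 1"] show False by linarith
  next
    case b: (finite b)
    show False
    proof (cases rule: l2_profile_inv_cases[of H1 \<mu>1 s])
      case infinite
      define A where "A = nat \<lceil>v powr 8\<rceil> + 1"
      have "v powr 8 < real A" unfolding A_def by linarith
      then have "(v powr 8) powr (1 / 8) < real A powr (1 / 8)" by (intro powr_less_mono2) auto
      moreover have "(v powr 8) powr (1 / 8) = v" using v unfolding powr_powr by simp
      moreover have "real A powr (1 / 8) \<le> v"
        using bound(2)[of A 1] infinite(2) b(1,4) by (simp add: A_def)
      ultimately show False by simp
    next
      case a: (finite a)
      note bd = bound[OF a(1) b(1) a(4) b(4)]
      have v_le: "v \<le> real a powr (real b / 272)"
      proof -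
        have e: "epowr (of_nat a) (of_nat b / ennreal 272) = ennreal (real a powr (real b / 272))"
          using a(1) b(1) by (rule epowr_of_nat) simp
        show ?thesis using le[unfolded a(2) b(2) e] by (subst (asm) ennreal_le_iff) auto
      qed
      show False
      proof (cases "a = 1")
        case True
        then have "v \<le> 1" using v_le by simp
        then show False using bd(1) b(1) nontrivial True a(2) b(2) by auto
      next
        case False
        then have "real a powr (real b / 272) < real a powr (real b / 8)"
          using a(1) b(1) by (intro powr_less_mono) auto
        then show False using v_le bd(2) by simp
      qed
    qed
  qed
qed


section \<open>Upper bound for the profile of a wreath product\<close>

text \<open>Since \<open>F\<close> below restricts to a multiple of \<open>\<phi>1\<close> or \<open>\<phi>2\<close> on each line, its Rayleigh quotient is known without
  computing its norm; it only has to be nonzero.\<close>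

lemma l2_profile_wreath_le:
  fixes H1 :: "('a, 'c) monoid_scheme" and H2 :: "('b, 'd) monoid_scheme"
  assumes H: "group H1" "group H2" and \<mu>: "set_pmf \<mu>1 \<subseteq> carrier H1" "set_pmf \<mu>2 \<subseteq> carrier H2"
    and fin: "finite (supp_on H1 \<phi>1)" "finite (supp_on H2 \<phi>2)"
    and norm: "sq_norm H1 \<phi>1 = 1" "sq_norm H2 \<phi>2 = 1"
    and v: "real (card (supp_on H1 \<phi>1) ^ card (supp_on H2 \<phi>2) * card (supp_on H2 \<phi>2)) \<le> v"
  shows "l2_profile (wreath_product H1 H2) (switch_or_walk H1 H2 \<mu>1 \<mu>2) v \<le>
    ennreal (1/2) * (dirichlet_form H1 \<mu>1 \<phi>1 + dirichlet_form H2 \<mu>2 \<phi>2)"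
proof -
  define W where "W = supp_on H2 \<phi>2"
  define S where "S = supp_on H1 \<phi>1"
  define E where "E = carrier (wreath_product H1 H2)"
  define trivial where "trivial f \<longleftrightarrow> (\<forall>x\<in>carrier H2 - W. f x = \<one>\<^bsub>H1\<^esub>)" for f :: "'b \<Rightarrow> 'a"
  define F where "F = (\<lambda>(f, h). (if trivial f then \<Prod>x\<in>W. \<phi>1 (f x) else 0) * \<phi>2 h)"
  define ext where "ext g = (\<lambda>x\<in>carrier H2. if x \<in> W then g x else \<one>\<^bsub>H1\<^esub>)" for g :: "'b \<Rightarrow> 'a"
  interpret H1: group H1 by fact
  interpret base: fibration H2 E "carrier (lamp_group H1 H2)" Pair fst
    unfolding E_def using H by (rule base_fibration)
  interpret lamp: fibration H1 E "lamp_lines H1 H2" lamp_inclusion "lamp_projection H1"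
    unfolding E_def using H by (rule lamp_fibration)
  have W: "finite W" "W \<subseteq> carrier H2" "W \<noteq> {}" "\<And>x. x \<in> W \<longleftrightarrow> x \<in> carrier H2 \<and> \<phi>2 x \<noteq> 0"
    using fin norm sq_norm_pos_iff[of H2 \<phi>2] by (auto simp: W_def supp_on_def)
  have S: "finite S" "S \<noteq> {}" "\<And>x. x \<in> S \<longleftrightarrow> x \<in> carrier H1 \<and> \<phi>1 x \<noteq> 0"
    using fin norm sq_norm_pos_iff[of H1 \<phi>1] by (auto simp: S_def supp_on_def)
  \<comment> \<open>A configuration in the support is determined by its values on \<open>W\<close>, which lie in \<open>S\<close>.\<close>
  have sub: "supp_on (wreath_product H1 H2) F \<subseteq> (\<lambda>(g, h). (ext g, h)) ` ((W \<rightarrow>\<^sub>E S) \<times> W)"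
  proof
    fix z assume z: "z \<in> supp_on (wreath_product H1 H2) F"
    obtain f h where fh: "z = (f, h)" by (cases z)
    have f: "f \<in> carrier (lamp_group H1 H2)" "h \<in> carrier H2" "trivial f" "\<phi>2 h \<noteq> 0" "\<And>x. x \<in> W \<Longrightarrow> \<phi>1 (f x) \<noteq> 0"
      using z W(1) by (auto simp: fh supp_on_def carrier_wreath_product F_def simp del: carrier_sum_group split: if_splits)
    have "f \<in> carrier H2 \<rightarrow>\<^sub>E carrier H1" using f(1) by (simp add: carrier_lamp_group[OF H(1)])
    then have "f = ext (restrict f W)" "restrict f W \<in> W \<rightarrow>\<^sub>E S"
      using f(3,5) W(2) S(3) by (auto simp: ext_def trivial_def fun_eq_iff PiE_iff extensional_def restrict_def)
    then show "z \<in> (\<lambda>(g, h). (ext g, h)) ` ((W \<rightarrow>\<^sub>E S) \<times> W)"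
      using f(2,4) W(4) by (auto simp: fh image_iff intro!: bexI[of _ "restrict f W"])
  qed
  have fin_big: "finite ((W \<rightarrow>\<^sub>E S) \<times> W)" using W(1) S(1) by (intro finite_cartesian_product finite_PiE) auto
  then have finF: "finite (supp_on (wreath_product H1 H2) F)"
    by (rule finite_subset[OF sub, OF finite_imageI])
  have "card (supp_on (wreath_product H1 H2) F) \<le> card ((\<lambda>(g, h). (ext g, h)) ` ((W \<rightarrow>\<^sub>E S) \<times> W))"
    using fin_big sub by (intro card_mono) auto
  also have "\<dots> \<le> card ((W \<rightarrow>\<^sub>E S) \<times> W)" using fin_big by (rule card_image_le)
  also have "\<dots> = card S ^ card W * card W" using W(1) by (simp add: card_cartesian_product card_PiE)
  finally have cardF: "real (card (supp_on (wreath_product H1 H2) F)) \<le> v"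
    using v unfolding S_def W_def by (meson of_nat_mono order_trans)
  obtain k0 h0 where k0: "k0 \<in> S" "h0 \<in> W" using S(2) W(3) by blast
  have "(ext (\<lambda>_. k0), h0) \<in> supp_on (wreath_product H1 H2) F"
  proof -
    have "{x \<in> carrier H2. ext (\<lambda>_. k0) x \<noteq> \<one>\<^bsub>H1\<^esub>} \<subseteq> W" by (auto simp: ext_def)
    then have "finite {x \<in> carrier H2. ext (\<lambda>_. k0) x \<noteq> \<one>\<^bsub>H1\<^esub>}" using W(1) finite_subset by blast
    then have "ext (\<lambda>_. k0) \<in> carrier (lamp_group H1 H2)"
      using k0 S(3) by (simp add: carrier_lamp_group[OF H(1)]) (auto simp: ext_def)
    moreover have "(\<Prod>x\<in>W. \<phi>1 (ext (\<lambda>_. k0) x)) = (\<Prod>x\<in>W. \<phi>1 k0)"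
      using W(2) by (intro prod.cong) (auto simp: ext_def)
    ultimately show ?thesis
      using k0 S(3) W(1,4)
      by (auto simp: supp_on_def carrier_wreath_product F_def trivial_def ext_def simp del: carrier_sum_group)
  qed
  then have pos: "0 < sq_norm (wreath_product H1 H2) F" using sq_norm_pos_iff[OF finF] by blast
  have slices1: "(\<integral>\<^sup>+l. dirichlet_form H1 \<mu>1 (\<lambda>k. F (lamp_inclusion l k)) \<partial>count_space (lamp_lines H1 H2)) =
      dirichlet_form H1 \<mu>1 \<phi>1 * ennreal (sq_norm (wreath_product H1 H2) F)"
  proof -
    have "\<exists>c. \<forall>k\<in>carrier H1. F (lamp_inclusion l k) = c * \<phi>1 k" if l_in: "l \<in> lamp_lines H1 H2" for l
    proof -
      obtain f h where l: "l = (f, h)" "h \<in> carrier H2" using l_in by (auto simp: lamp_lines_def)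
      show ?thesis
      \<comment> \<open>Off \<open>W\<close> the factor \<open>\<phi>2 h\<close> vanishes; on \<open>W\<close> the lamp at \<open>h\<close> enters exactly one factor of the product.\<close>
      proof (cases "h \<in> W")
        case False
        then show ?thesis using W(4) l(2) by (intro exI[of _ 0]) (simp add: F_def l lamp_inclusion_def)
      next
        case True
        have triv: "trivial (f(h := k)) \<longleftrightarrow> trivial f" for k using True by (auto simp: trivial_def)
        have "(\<Prod>x\<in>W. \<phi>1 ((f(h := k)) x)) = \<phi>1 k * (\<Prod>x\<in>W - {h}. \<phi>1 (f x))" for k
        proof -
          have "(\<Prod>x\<in>W. \<phi>1 ((f(h := k)) x)) = \<phi>1 ((f(h := k)) h) * (\<Prod>x\<in>W - {h}. \<phi>1 ((f(h := k)) x))"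
            using W(1) True by (rule prod.remove)
          also have "(\<Prod>x\<in>W - {h}. \<phi>1 ((f(h := k)) x)) = (\<Prod>x\<in>W - {h}. \<phi>1 (f x))"
            by (rule prod.cong) auto
          finally show ?thesis by simp
        qed
        then show ?thesis
          by (intro exI[of _ "(if trivial f then \<Prod>x\<in>W - {h}. \<phi>1 (f x) else 0) * \<phi>2 h"])
             (simp only: F_def l lamp_inclusion_def prod.case triv, simp)
      qed
    qed
    from lamp.nn_integral_dirichlet_form_proportional[OF \<mu>(1) fin(1) this] show ?thesis
      by (simp add: norm ennreal_sq_norm_nn_integral[OF finF] E_def)
  qed
  have slices2: "(\<integral>\<^sup>+f. dirichlet_form H2 \<mu>2 (\<lambda>h. F (f, h)) \<partial>count_space (carrier (lamp_group H1 H2))) =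
      dirichlet_form H2 \<mu>2 \<phi>2 * ennreal (sq_norm (wreath_product H1 H2) F)"
  proof -
    have "\<exists>c. \<forall>h\<in>carrier H2. F (f, h) = c * \<phi>2 h" if "f \<in> carrier (lamp_group H1 H2)" for f
      by (auto simp: F_def)
    from base.nn_integral_dirichlet_form_proportional[OF \<mu>(2) fin(2) this] show ?thesis
      by (simp add: norm ennreal_sq_norm_nn_integral[OF finF] E_def)
  qed
  have "l2_profile (wreath_product H1 H2) (switch_or_walk H1 H2 \<mu>1 \<mu>2) v * ennreal (sq_norm (wreath_product H1 H2) F)
      \<le> dirichlet_form (wreath_product H1 H2) (switch_or_walk H1 H2 \<mu>1 \<mu>2) F"
    using set_pmf_switch_or_walk[OF H \<mu>] finF cardF by (rule l2_profile_le_rayleigh)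
  also have "\<dots> = ennreal (1/2) * (dirichlet_form H1 \<mu>1 \<phi>1 + dirichlet_form H2 \<mu>2 \<phi>2) * ennreal (sq_norm (wreath_product H1 H2) F)"
    unfolding dirichlet_form_switch_or_walk[OF H \<mu>] slices1 slices2 by (simp add: distrib_left distrib_right ac_simps)
  finally show ?thesis
    using pos by (simp add: ennreal_mult_le_mult_iff mult.commute[of _ "ennreal (sq_norm _ _)"])
qed

text \<open>The infimum in the profile need not be attained, so the test functions are only near minimisers, up to
  \<open>e\<close>.\<close>

lemma wreath_profile_upper_bound:
  fixes H1 :: "('a, 'c) monoid_scheme" and H2 :: "('b, 'd) monoid_scheme"
  assumes H: "group H1" "group H2" and \<mu>: "set_pmf \<mu>1 \<subseteq> carrier H1" "set_pmf \<mu>2 \<subseteq> carrier H2"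
    and s: "0 < s"
    and ge: "epowr (l2_profile_inv H1 \<mu>1 s) (l2_profile_inv H2 \<mu>2 s) * l2_profile_inv H2 \<mu>2 s \<le> ennreal v"
  shows "l2_profile (wreath_product H1 H2) (switch_or_walk H1 H2 \<mu>1 \<mu>2) v \<le> ennreal s"
proof -
  have nz: "epowr x y \<noteq> 0" if "1 \<le> x" for x y
  proof -
    have "0 < enn2real x" if "x \<noteq> \<infinity>" using \<open>1 \<le> x\<close> that by (simp add: enn2real_positive_iff less_le_trans[of 0 1] top.not_eq_extremum)
    then show ?thesis by (auto simp: epowr_def)
  qed
  have inv1: "1 \<le> l2_profile_inv H1 \<mu>1 s"
    by (cases rule: l2_profile_inv_cases[of H1 \<mu>1 s]) auto
  obtain b where b: "1 \<le> b" "l2_profile_inv H2 \<mu>2 s = of_nat b" "l2_profile H2 \<mu>2 (real b) \<le> ennreal s"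
  proof (cases rule: l2_profile_inv_cases[of H2 \<mu>2 s])
    case infinite
    then show ?thesis using ge nz[OF inv1] by (simp add: ennreal_mult_top top_unique)
  qed (use that in blast)
  obtain a where a: "1 \<le> a" "l2_profile_inv H1 \<mu>1 s = of_nat a" "l2_profile H1 \<mu>1 (real a) \<le> ennreal s"
  proof (cases rule: l2_profile_inv_cases[of H1 \<mu>1 s])
    case infinite
    then show ?thesis using ge b by (simp add: epowr_def ennreal_top_mult top_unique)
  qed (use that in blast)
  have "ennreal (real (a ^ b * b)) \<le> ennreal v"
  proof -
    have "epowr (of_nat a) (of_nat b) = ennreal (real a powr real b)"
      using epowr_of_nat[OF a(1) b(1), of 1] by (simp add: divide_ennreal_def)
    also have "\<dots> = ennreal (real (a ^ b))" using a(1) by (simp add: powr_realpow)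
    finally show ?thesis
      using ge unfolding a(2) b(2) by (simp add: ennreal_of_nat_eq_real_of_nat ennreal_mult)
  qed
  moreover have "0 < real (a ^ b * b)" using a(1) b(1) by simp
  ultimately have v: "real (a ^ b * b) \<le> v" by (subst (asm) ennreal_le_iff2) auto
  show ?thesis
  proof (rule ennreal_le_epsilon)
    fix e :: real assume e: "0 < e"
    have lt: "ennreal s < ennreal (s + e)" using s e by (simp add: ennreal_lessI)
    have "l2_profile H1 \<mu>1 (real a) < ennreal (s + e)" "l2_profile H2 \<mu>2 (real b) < ennreal (s + e)"
      using a(3) b(3) lt by (blast intro: le_less_trans)+
    then obtain \<phi>1 \<phi>2 where \<phi>1: "finite (supp_on H1 \<phi>1)" "card (supp_on H1 \<phi>1) \<le> a" "l2_norm_on H1 \<phi>1 = 1"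
        "dirichlet_form H1 \<mu>1 \<phi>1 < ennreal (s + e)"
      and \<phi>2: "finite (supp_on H2 \<phi>2)" "card (supp_on H2 \<phi>2) \<le> b" "l2_norm_on H2 \<phi>2 = 1"
        "dirichlet_form H2 \<mu>2 \<phi>2 < ennreal (s + e)"
      unfolding l2_profile_def INF_less_iff by auto
    have norm: "sq_norm H1 \<phi>1 = 1" "sq_norm H2 \<phi>2 = 1"
      using \<phi>1(3) \<phi>2(3) by (simp_all add: l2_norm_on_eq_sqrt_sq_norm \<phi>1(1) \<phi>2(1))
    have "card (supp_on H1 \<phi>1) ^ card (supp_on H2 \<phi>2) \<le> a ^ card (supp_on H2 \<phi>2)"
      using \<phi>1(2) by (rule power_mono) simp
    also have "\<dots> \<le> a ^ b" using \<phi>2(2) a(1) by (rule power_increasing)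
    finally have "card (supp_on H1 \<phi>1) ^ card (supp_on H2 \<phi>2) * card (supp_on H2 \<phi>2) \<le> a ^ b * b"
      using \<phi>2(2) by (intro mult_mono) auto
    then have "real (card (supp_on H1 \<phi>1) ^ card (supp_on H2 \<phi>2) * card (supp_on H2 \<phi>2)) \<le> v"
      using v by (meson of_nat_mono order_trans)
    then have "l2_profile (wreath_product H1 H2) (switch_or_walk H1 H2 \<mu>1 \<mu>2) v \<le>
        ennreal (1/2) * (dirichlet_form H1 \<mu>1 \<phi>1 + dirichlet_form H2 \<mu>2 \<phi>2)"
      by (rule l2_profile_wreath_le[OF H \<mu> \<phi>1(1) \<phi>2(1) norm])
    also have "\<dots> \<le> ennreal (1/2) * (ennreal (s + e) + ennreal (s + e))"
      using \<phi>1(4) \<phi>2(4) by (intro mult_left_mono add_mono) auto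
    also have "\<dots> = ennreal (1/2 * ((s + e) + (s + e)))"
    proof -
      have "ennreal ((s + e) + (s + e)) = ennreal (s + e) + ennreal (s + e)"
        using s e by (intro ennreal_plus) auto
      moreover have "ennreal (1/2 * ((s + e) + (s + e))) = ennreal (1/2) * ennreal ((s + e) + (s + e))"
        using s e by (intro ennreal_mult) auto
      ultimately show ?thesis by (simp only:)
    qed
    also have "1/2 * ((s + e) + (s + e)) = s + e" by simp
    also have "ennreal (s + e) = ennreal s + ennreal e" using s e by (intro ennreal_plus) auto
    finally show "l2_profile (wreath_product H1 H2) (switch_or_walk H1 H2 \<mu>1 \<mu>2) v \<le> ennreal s + ennreal e" .
  qed
qed


section \<open>The profile of a wreath product\<close>

theorem theorem1p9:
  shows "\<exists>K::real. K > 0 \<and>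
    (\<forall>(H1 :: nat monoid) (H2 :: nat monoid) (\<mu>1 :: nat pmf) (\<mu>2 :: nat pmf).
       finitely_generated_group H1 \<longrightarrow> finitely_generated_group H2 \<longrightarrow>
       symmetric_pmf_on H1 \<mu>1 \<longrightarrow> symmetric_pmf_on H2 \<mu>2 \<longrightarrow>
       (\<forall>s>0. \<forall>v>0.
          ennreal v \<le> epowr (l2_profile_inv H1 \<mu>1 s) (l2_profile_inv H2 \<mu>2 s / ennreal K) \<longrightarrow>
          \<not> (v = 1 \<and> l2_profile_inv H1 \<mu>1 s = 1 \<and> l2_profile_inv H2 \<mu>2 s = 1) \<longrightarrow>
          l2_profile (wreath_product H1 H2) (switch_or_walk H1 H2 \<mu>1 \<mu>2) v \<ge> ennreal (s / K)) \<and>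
       (\<forall>s>0. \<forall>v>0.
          ennreal v \<ge> epowr (l2_profile_inv H1 \<mu>1 s) (l2_profile_inv H2 \<mu>2 s)
                         * l2_profile_inv H2 \<mu>2 s \<longrightarrow>
          l2_profile (wreath_product H1 H2) (switch_or_walk H1 H2 \<mu>1 \<mu>2) v \<le> ennreal s))"
  unfolding finitely_generated_group_def symmetric_pmf_on_def
  by (intro exI[of _ "272::real"] conjI allI impI)
     (simp, (elim conjE, rule wreath_profile_lower_bound; assumption),
      (elim conjE, rule wreath_profile_upper_bound; assumption))

end
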